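(* For every convex $d$-polytope $P$ with $d>0$ and every generic sweep direction $p$, \[\Phi(P)=\sum_{v\in\mathrm{vert}(P)}\tfrac12\left[\mathbf{c}\,\Phi(Q_v)+(2\mathbf{d}-\mathbf{c}^2)\,\Phi(R_v)\right].\] (For $d=0$, $\Phi(P)=1$.)
   Context: The $\mathbf{cd}$-index: for a convex $d$-polytope $P$ and $S=\{s_1<\dots<s_k\}\subseteq\{0,\dots,d-1\}$ let $f_S(P)$ be the number of chains $F_1\subset\cdots\subset F_k$ of faces with $\dim F_i=s_i$, $h_S=\sum_{T\subseteq S}(-1)^{|S|-|T|}f_T$, $\Psi(P)=\sum_S h_Sw_S$ where $w_S=w_0\cdots w_{d-1}$ in noncommuting $\mathbf{a},\mathbf{b}$ with $w_i=\mathbf{b}$ iff $i\in S$ and $\mathbf{a}$ otherwise. $\Phi(P)$ is the polynomial in noncommuting $\mathbf{c},\mathbf{d}$ with $\Phi(\mathbf{a}+\mathbf{b},\mathbf{ab}+\mathbf{ba})=\Psi(P)$; $\Phi$ of a point is $1$, and $\Phi(\emptyset)=0$. Coefficients here are rational. Sweeping: $p\in\mathbb{R}^d$ with $p\cdot x$ distinct on the vertices of $P$ and of all polytopes below. For a vertex $v$: $Q_v$ is the vertex figure, the $(d-1)$-polytope obtained by intersecting $P$ with a translate, a sufficiently small depth into $P$, of a supporting hyperplane meeting $P$ only in $v$; $H_v=\{x:p\cdot x=p\cdot v\}$; $R_v=Q_v\cap H_v$ (empty iff $v$ minimizes or maximizes $p\cdot x$ on $P$, otherwise a $(d-2)$-polytope).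 *)

theory Defs
  imports "HOL-Analysis.Analysis" "HOL-Library.Poly_Mapping"
begin

text \<open>
  Words form a monoid under concatenation. Written additively, this is what
  \<open>Poly_Mapping\<close> expects of its exponents, so that \<open>'x list \<Rightarrow>\<^sub>0 rat\<close> with its
  library multiplication is the free associative algebra over the rationals on
  the letters \<open>'x\<close>.
\<close>

instantiation list :: (type) monoid_add
begin

definition zero_list :: "'a list" where "zero_list = []"

definition plus_list :: "'a list \<Rightarrow> 'a list \<Rightarrow> 'a list" where "plus_list = (@)"

instance
  by standard (simp_all add: zero_list_def plus_list_def)

end

type_synonym 'x ncpoly = "'x list \<Rightarrow>\<^sub>0 rat"

definition nc_word :: "'x list \<Rightarrow> 'x ncpoly" where
  "nc_word w = Poly_Mapping.single w 1"

definition nc_scalar :: "rat \<Rightarrow> 'x ncpoly" where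
  "nc_scalar q = Poly_Mapping.single [] q"

datatype ab_letter = LA | LB

datatype cd_letter = LC | LD

definition c_poly :: "cd_letter ncpoly" where "c_poly = nc_word [LC]"

definition d_poly :: "cd_letter ncpoly" where "d_poly = nc_word [LD]"

fun cd_letter_to_ab :: "cd_letter \<Rightarrow> ab_letter ncpoly" where
  "cd_letter_to_ab LC = nc_word [LA] + nc_word [LB]"
| "cd_letter_to_ab LD = nc_word [LA] * nc_word [LB] + nc_word [LB] * nc_word [LA]"

definition cd_to_ab :: "cd_letter ncpoly \<Rightarrow> ab_letter ncpoly" where
  "cd_to_ab \<phi> = (\<Sum>w\<in>Poly_Mapping.keys \<phi>.
     nc_scalar (Poly_Mapping.lookup \<phi> w) * prod_list (map cd_letter_to_ab w))"

text \<open>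
  A chain with dimension set \<open>S\<close> is indexed by its dimensions. Note that
  \<open>face_of\<close> admits the empty face (of dimension -1) and the improper
  face \<open>P\<close>; neither can occur when \<open>S\<close> consists of
  natural numbers less than the dimension of \<open>P\<close>.
\<close>

definition flag_chains :: "'a::euclidean_space set \<Rightarrow> nat set \<Rightarrow> (nat \<Rightarrow> 'a set) set" where
  "flag_chains P S =
     {F \<in> (\<Pi>\<^sub>E s\<in>S. {G. G face_of P \<and> aff_dim G = int s}). strict_mono_on S F}"

definition flag_f :: "'a::euclidean_space set \<Rightarrow> nat set \<Rightarrow> nat" where
  "flag_f P S = card (flag_chains P S)"

definition flag_h :: "'a::euclidean_space set \<Rightarrow> nat set \<Rightarrow> rat" where
  "flag_h P S = (\<Sum>T\<in>Pow S. (-1) ^ (card S - card T) * of_nat (flag_f P T))"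

definition ab_word :: "nat \<Rightarrow> nat set \<Rightarrow> ab_letter list" where
  "ab_word d S = map (\<lambda>i. if i \<in> S then LB else LA) [0..<d]"

definition ab_index :: "'a::euclidean_space set \<Rightarrow> ab_letter ncpoly" where
  "ab_index P = (let d = nat (aff_dim P) in
     \<Sum>S\<in>Pow {..<d}. nc_scalar (flag_h P S) * nc_word (ab_word d S))"

text \<open>
  For a point, the only chain is the empty one and the only word is the empty
  one, so the defining equation reads \<open>cd_to_ab \<phi> = 1\<close>.
\<close>

definition cd_index :: "'a::euclidean_space set \<Rightarrow> cd_letter ncpoly" where
  "cd_index P = (if P = {} then 0 else (THE \<phi>. cd_to_ab \<phi> = ab_index P))"

definition vert :: "'a::euclidean_space set \<Rightarrow> 'a set" where
  "vert P = {v. v extreme_point_of P}"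

text \<open>
  The translate of the supporting hyperplane is pushed in by \<open>e\<close>. The depth is
  sufficiently small when every other vertex of \<open>P\<close> stays strictly beyond the
  translate.
\<close>

definition is_vertex_figure ::
    "'a::euclidean_space set \<Rightarrow> 'a \<Rightarrow> 'a set \<Rightarrow> bool" where
  "is_vertex_figure P v Q \<longleftrightarrow>
     (\<exists>a b e. a \<noteq> 0 \<and> P \<subseteq> {x. a \<bullet> x \<le> b} \<and> P \<inter> {x. a \<bullet> x = b} = {v} \<and>
        0 < e \<and> (\<forall>u\<in>vert P - {v}. a \<bullet> u < b - e) \<and>
        Q = P \<inter> {x. a \<bullet> x = b - e})"

definition sweep_hyperplane :: "'a::euclidean_space \<Rightarrow> 'a \<Rightarrow> 'a set" where
  "sweep_hyperplane p v = {x. p \<bullet> x = p \<bullet> v}"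

end

theory Submission
  imports Defs
begin

text \<open>
  Writing \<open>\<Psi>(\<a>, \<b>) = \<Upsilon>(\<a> - \<b>, \<b>)\<close> with \<open>\<Upsilon>\<close> the generating function of the flag numbers \<open>f\<^sub>S\<close>,
  the recursion becomes \<open>2\<Upsilon>(P) = \<Sum>\<^sub>v (\<a> + 2\<b>)\<Upsilon>(Q\<^sub>v) - \<a>\<^sup>2\<Upsilon>(R\<^sub>v)\<close>, which is a double count.
  Chains starting at the vertex \<open>v\<close> are chains of \<open>Q\<^sub>v\<close>. For a chain without a vertex, the chains of
  \<open>Q\<^sub>v\<close> count the pairs \<open>(v, chain)\<close> with \<open>v\<close> in the lowest face, and those of \<open>R\<^sub>v\<close> count the pairs
  where \<open>v\<close> neither minimizes nor maximizes \<open>p\<close> on that face; every face of positive dimension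
  has exactly two vertices which do. The recursion also yields the existence of the
  \<open>\<c>\<d>\<close>-index by induction on the dimension; uniqueness is the injectivity of the substitution.
\<close>

subsection \<open>Free algebras\<close>

lemma nc_poly_eq_sum_single:
  "(x :: 'x ncpoly) = (\<Sum>w\<in>Poly_Mapping.keys x. Poly_Mapping.single w (Poly_Mapping.lookup x w))"
  by (rule poly_mapping_eqI) (auto simp: lookup_sum lookup_single when_def in_keys_iff)

text \<open>For additive properties, checking monomials suffices. Zero needs no case of its own,
  being a monomial with coefficient 0.\<close>

lemma nc_poly_induct [case_names single add]:
  fixes x :: "'x ncpoly"
  assumes "\<And>w q. P (Poly_Mapping.single w q)"
    and "\<And>x y. P x \<Longrightarrow> P y \<Longrightarrow> P (x + y)"
  shows "P x"
proof -
  have "P (\<Sum>w\<in>S. Poly_Mapping.single w (Poly_Mapping.lookup x w))" if "finite S" for S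
    using that
  proof induction
    case empty
    show ?case using assms(1)[of "[]" 0] by simp
  qed (use assms in auto)
  then show ?thesis
    using nc_poly_eq_sum_single[of x] by (metis finite_keys)
qed

lemma nc_scalar_0 [simp]: "nc_scalar 0 = 0"
  by (simp add: nc_scalar_def)

lemma nc_scalar_1 [simp]: "nc_scalar 1 = 1"
  by (metis nc_scalar_def single_one zero_list_def)

lemma nc_word_Nil [simp]: "nc_word [] = 1"
  by (metis nc_word_def single_one zero_list_def)

lemma nc_word_append: "nc_word (u @ v) = nc_word u * nc_word v"
  by (simp add: nc_word_def mult_single plus_list_def)

lemma nc_scalar_add: "nc_scalar (a + b) = nc_scalar a + nc_scalar b"
  by (simp add: nc_scalar_def single_add)

lemma nc_scalar_diff: "nc_scalar (a - b) = nc_scalar a - nc_scalar b"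
  by (simp add: nc_scalar_def single_diff)

lemma nc_scalar_uminus: "nc_scalar (- q) = - nc_scalar q"
  using nc_scalar_diff[of 0 q] by simp

lemma nc_scalar_mult: "nc_scalar (a * b) = nc_scalar a * nc_scalar b"
  by (simp add: nc_scalar_def mult_single plus_list_def)

lemma nc_scalar_sum: "nc_scalar (sum f S) = (\<Sum>x\<in>S. nc_scalar (f x))"
  by (induction S rule: infinite_finite_induct) (auto simp: nc_scalar_add)

text \<open>Scalars are central because they are supported on the empty word, the unit of
  concatenation; the letters themselves do not commute.\<close>

lemma nc_scalar_commute: "nc_scalar q * x = x * nc_scalar q"
proof (induction x rule: nc_poly_induct)
  case (single w r)
  then show ?case
    by (simp add: nc_scalar_def mult_single plus_list_def mult.commute)
qed (simp add: algebra_simps)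

lemma nc_scalar_left_commute: "x * (nc_scalar q * y) = nc_scalar q * (x * y)"
  by (metis mult.assoc nc_scalar_commute)

lemma lookup_nc_scalar: "Poly_Mapping.lookup (nc_scalar q) w = (if w = [] then q else 0)"
  by (simp add: nc_scalar_def lookup_single when_def)

lemma lookup_letter_mult_Nil [simp]: "Poly_Mapping.lookup (nc_word [l] * x) [] = 0"
  by (induction x rule: nc_poly_induct)
    (simp_all add: nc_word_def mult_single plus_list_def lookup_single algebra_simps lookup_add)

lemma lookup_letter_mult_Cons [simp]:
  "Poly_Mapping.lookup (nc_word [l] * x) (m # w) = (if l = m then Poly_Mapping.lookup x w else 0)"
  by (induction x rule: nc_poly_induct)
    (auto simp add: nc_word_def mult_single plus_list_def lookup_single algebra_simps lookup_add when_def)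

subsection \<open>The substitution of \<open>\<a>\<b>\<close>-polynomials\<close>

text \<open>The support changes under addition, so \<open>cd_to_ab\<close> is first rewritten over
  an arbitrary finite superset of it. On a common superset additivity is termwise.\<close>

lemma cd_to_ab_superset:
  assumes "finite S" "Poly_Mapping.keys \<phi> \<subseteq> S"
  shows "cd_to_ab \<phi> = (\<Sum>w\<in>S. nc_scalar (Poly_Mapping.lookup \<phi> w) * prod_list (map cd_letter_to_ab w))"
  unfolding cd_to_ab_def
  by (rule sum.mono_neutral_left) (use assms in \<open>auto simp: in_keys_iff\<close>)

lemma cd_to_ab_add: "cd_to_ab (x + y) = cd_to_ab x + cd_to_ab y"
proof -
  let ?S = "Poly_Mapping.keys x \<union> Poly_Mapping.keys y"
  have "Poly_Mapping.keys (x + y) \<subseteq> ?S"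
    by (rule keys_add)
  then show ?thesis
    by (simp add: cd_to_ab_superset[of ?S] lookup_add nc_scalar_add distrib_right sum.distrib)
qed

lemma cd_to_ab_single:
  "cd_to_ab (Poly_Mapping.single w q) = nc_scalar q * prod_list (map cd_letter_to_ab w)"
  by (simp add: cd_to_ab_superset[of "{w}"])

lemma cd_to_ab_0 [simp]: "cd_to_ab 0 = 0"
  by (simp add: cd_to_ab_def)

lemma cd_to_ab_scalar [simp]: "cd_to_ab (nc_scalar q) = nc_scalar q"
  by (simp add: nc_scalar_def[where 'x = cd_letter] cd_to_ab_single)

lemma cd_to_ab_1 [simp]: "cd_to_ab 1 = 1"
  using cd_to_ab_scalar[of 1] by simp

lemma cd_to_ab_sum: "cd_to_ab (sum f S) = (\<Sum>x\<in>S. cd_to_ab (f x))"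
  by (induction S rule: infinite_finite_induct) (auto simp: cd_to_ab_add)

lemma cd_to_ab_mult: "cd_to_ab (x * y) = cd_to_ab x * cd_to_ab y"
proof (induction x rule: nc_poly_induct)
  case (single w q)
  show ?case
  proof (induction y rule: nc_poly_induct)
    case (single v r)
    then show ?case
      by (simp add: mult_single cd_to_ab_single plus_list_def nc_scalar_mult mult.assoc
          nc_scalar_left_commute[of "prod_list (map cd_letter_to_ab w)"])
  qed (simp add: distrib_left cd_to_ab_add)
qed (simp add: distrib_right cd_to_ab_add)

lemma cd_to_ab_uminus: "cd_to_ab (- x) = - cd_to_ab x"
  using cd_to_ab_add[of x "- x"] by (simp add: minus_unique)

lemma cd_to_ab_diff: "cd_to_ab (x - y) = cd_to_ab x - cd_to_ab y"
  using cd_to_ab_add[of x "- y"] by (simp add: cd_to_ab_uminus)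

lemma cd_to_ab_c: "cd_to_ab c_poly = nc_word [LA] + nc_word [LB]"
  by (simp add: c_poly_def nc_word_def[where 'x = cd_letter] cd_to_ab_single)

lemma cd_to_ab_d: "cd_to_ab d_poly = nc_word [LA] * nc_word [LB] + nc_word [LB] * nc_word [LA]"
  by (simp add: d_poly_def nc_word_def[where 'x = cd_letter] cd_to_ab_single)

section \<open>Injectivity of the substitution\<close>

lemma cd_poly_decompose:
  fixes \<phi> :: "cd_letter ncpoly"
  assumes "\<And>w. w \<in> Poly_Mapping.keys \<phi> \<Longrightarrow> length w < Suc n"
  obtains q \<phi>\<^sub>c \<phi>\<^sub>d where "\<phi> = nc_scalar q + c_poly * \<phi>\<^sub>c + d_poly * \<phi>\<^sub>d"
    "\<And>w. w \<in> Poly_Mapping.keys \<phi>\<^sub>c \<Longrightarrow> length w < n"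
    "\<And>w. w \<in> Poly_Mapping.keys \<phi>\<^sub>d \<Longrightarrow> length w < n"
proof
  \<comment> \<open>\<open>map_key ((#) l)\<close> collects the words that begin with
    \<open>l\<close> and strips that letter, so the length bound drops by one.\<close>
  let ?c = "Poly_Mapping.map_key ((#) LC) \<phi>" and ?d = "Poly_Mapping.map_key ((#) LD) \<phi>"
  have inj: "inj ((#) l)" for l :: cd_letter
    by (simp add: inj_def)
  show "\<phi> = nc_scalar (Poly_Mapping.lookup \<phi> []) + c_poly * ?c + d_poly * ?d"
  proof (rule poly_mapping_eqI)
    fix w
    show "Poly_Mapping.lookup \<phi> w = Poly_Mapping.lookup
       (nc_scalar (Poly_Mapping.lookup \<phi> []) + c_poly * ?c + d_poly * ?d) w"
    proof (cases w)
      case (Cons l w')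
      then show ?thesis
        by (cases l)
          (simp_all add: c_poly_def d_poly_def lookup_add lookup_nc_scalar map_key.rep_eq[OF inj])
    qed (simp add: c_poly_def d_poly_def lookup_add lookup_nc_scalar)
  qed
  show "length w < n" if "w \<in> Poly_Mapping.keys ?c" for w
    using that assms[of "LC # w"] by (simp add: keys_map_key[OF inj])
  show "length w < n" if "w \<in> Poly_Mapping.keys ?d" for w
    using that assms[of "LD # w"] by (simp add: keys_map_key[OF inj])
qed

lemma letters_independent:
  assumes "nc_scalar q + nc_word [LA] * x + nc_word [LB] * y = 0"
  shows "q = 0" "x = 0" "y = 0"
proof -
  have *: "Poly_Mapping.lookup (nc_scalar q + nc_word [LA] * x + nc_word [LB] * y) w = 0" for w
    by (simp add: assms)
  show "q = 0"
    using *[of "[]"] by (simp add: lookup_add lookup_nc_scalar)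
  show "x = 0"
    by (rule poly_mapping_eqI) (use *[of "LA # w" for w] in \<open>simp add: lookup_add lookup_nc_scalar\<close>)
  show "y = 0"
    by (rule poly_mapping_eqI) (use *[of "LB # w" for w] in \<open>simp add: lookup_add lookup_nc_scalar\<close>)
qed

text \<open>Induction on a bound for the word lengths. Writing x and y for the images of the two
  parts of \<phi> behind a leading c and d, the image of \<phi> is q + a(x + by) + b(x + ay), and
  words with different first letters cannot cancel.\<close>

lemma cd_to_ab_eq_0:
  assumes "cd_to_ab \<phi> = 0"
  shows "\<phi> = 0"
proof -
  have "\<phi> = 0" if "\<And>w. w \<in> Poly_Mapping.keys \<phi> \<Longrightarrow> length w < n" "cd_to_ab \<phi> = 0" for n
    using that
  proof (induction n arbitrary: \<phi>)
    case 0
    then have "Poly_Mapping.keys \<phi> = {}"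
      by blast
    then show ?case
      by simp
  next
    case (Suc n)
    obtain q \<phi>\<^sub>c \<phi>\<^sub>d where \<phi>: "\<phi> = nc_scalar q + c_poly * \<phi>\<^sub>c + d_poly * \<phi>\<^sub>d"
      and len: "\<And>w. w \<in> Poly_Mapping.keys \<phi>\<^sub>c \<Longrightarrow> length w < n"
        "\<And>w. w \<in> Poly_Mapping.keys \<phi>\<^sub>d \<Longrightarrow> length w < n"
      using cd_poly_decompose Suc.prems(1) by blast
    let ?a = "nc_word [LA]" and ?b = "nc_word [LB]"
    have "nc_scalar q + ?a * (cd_to_ab \<phi>\<^sub>c + ?b * cd_to_ab \<phi>\<^sub>d) +
        ?b * (cd_to_ab \<phi>\<^sub>c + ?a * cd_to_ab \<phi>\<^sub>d) = 0"
      using Suc.prems(2)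
      by (simp add: \<phi> cd_to_ab_add cd_to_ab_mult cd_to_ab_c cd_to_ab_d algebra_simps)
    note ind = letters_independent[OF this]
    \<comment> \<open>The difference of the two vanishing brackets; its two products again begin
      with different letters.\<close>
    have "nc_scalar 0 + ?a * cd_to_ab \<phi>\<^sub>d + ?b * (- cd_to_ab \<phi>\<^sub>d) = 0"
      using ind(2,3) by (simp add: algebra_simps) (metis add_left_cancel)
    then have "cd_to_ab \<phi>\<^sub>d = 0"
      by (rule letters_independent)
    moreover from this have "cd_to_ab \<phi>\<^sub>c = 0"
      using ind(2) by simp
    ultimately have "\<phi>\<^sub>c = 0" "\<phi>\<^sub>d = 0"
      using Suc.IH len by blast+
    then show ?case
      using ind(1) by (simp add: \<phi>)
  qed
  from this[of "Suc (Max (length ` Poly_Mapping.keys \<phi>))"] assms show ?thesis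
    by (simp add: le_imp_less_Suc)
qed

lemma inj_cd_to_ab: "inj cd_to_ab"
  by (metis (no_types, lifting) cd_to_ab_diff cd_to_ab_eq_0 injI eq_iff_diff_eq_0)

subsection \<open>The flag generating function\<close>

text \<open>The monomials of \<Upsilon>(a - b, b): the word of \<open>T\<close> with every a
  replaced by a - b.\<close>

definition flag_word :: "nat \<Rightarrow> nat set \<Rightarrow> ab_letter ncpoly" where
  "flag_word d T =
     prod_list (map (\<lambda>i. if i \<in> T then nc_word [LB] else nc_word [LA] - nc_word [LB]) [0..<d])"

definition flag_gen :: "nat \<Rightarrow> (nat set \<Rightarrow> rat) \<Rightarrow> ab_letter ncpoly" where
  "flag_gen d f = (\<Sum>T\<in>Pow {..<d}. nc_scalar (f T) * flag_word d T)"

lemma Pow_lessThan_Suc: "Pow {..<Suc d} = Pow {..<d} \<union> insert d ` Pow {..<d}"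
  by (simp add: lessThan_Suc Pow_insert)

lemma Pow_Suc_split: "Pow {..<Suc d} = (`) Suc ` Pow {..<d} \<union> (\<lambda>T. insert 0 (Suc ` T)) ` Pow {..<d}"
proof -
  have "{..<Suc d} = insert 0 (Suc ` {..<d})"
    by (rule lessThan_Suc_eq_insert_0)
  then show ?thesis
    by (simp add: Pow_insert image_Pow_surj[OF refl, symmetric] image_image)
qed

lemma ab_word_Suc: "nc_word (ab_word (Suc d) S) = nc_word (ab_word d S) * nc_word [if d \<in> S then LB else LA]"
  by (simp add: ab_word_def nc_word_append)

lemma ab_word_cong:
  assumes "S \<inter> {..<d} = S' \<inter> {..<d}"
  shows "ab_word d S = ab_word d S'"
proof -
  have "i \<in> S \<longleftrightarrow> i \<in> S'" if "i < d" for i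
    using assms that by blast
  then show ?thesis
    by (simp add: ab_word_def)
qed

lemma flag_word_cong:
  assumes "S \<inter> {..<d} = S' \<inter> {..<d}"
  shows "flag_word d S = flag_word d S'"
proof -
  have "i \<in> S \<longleftrightarrow> i \<in> S'" if "i < d" for i
    using assms that by blast
  then show ?thesis
    unfolding flag_word_def by (intro arg_cong[where f = prod_list] map_cong) auto
qed

lemma flag_word_Suc:
  "flag_word (Suc d) T = flag_word d T * (if d \<in> T then nc_word [LB] else nc_word [LA] - nc_word [LB])"
  by (simp add: flag_word_def)

lemma flag_word_shift:
  "flag_word (Suc d) (Suc ` T) = (nc_word [LA] - nc_word [LB]) * flag_word d T"
  "flag_word (Suc d) (insert 0 (Suc ` T)) = nc_word [LB] * flag_word d T"
  unfolding flag_word_def upt_conv_Cons[OF zero_less_Suc] map_Suc_upt[symmetric]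
  by (simp_all add: o_def image_iff)

text \<open>The subsets are sorted by whether they contain 0, which fixes the first factor, and the
  rest is shifted down by one. This matches the drop in dimension from a polytope to a hyperplane
  section.\<close>

lemma flag_gen_Suc:
  "flag_gen (Suc d) f =
     (nc_word [LA] - nc_word [LB]) * flag_gen d (\<lambda>T. f (Suc ` T)) +
     nc_word [LB] * flag_gen d (\<lambda>T. f (insert 0 (Suc ` T)))"
proof -
  have disj: "(`) Suc ` Pow {..<d} \<inter> (\<lambda>T. insert 0 (Suc ` T)) ` Pow {..<d} = {}"
    by auto
  have inj1: "inj_on ((`) Suc) (Pow {..<d})"
    by (auto simp: inj_on_def inj_image_eq_iff)
  have inj2: "inj_on (\<lambda>T. insert 0 (Suc ` T)) (Pow {..<d})"
    by (auto simp: inj_on_def insert_eq_iff inj_image_eq_iff)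
  show ?thesis
    unfolding flag_gen_def Pow_Suc_split
    by (subst sum.union_disjoint)
      (use disj in \<open>auto simp: sum.reindex[OF inj1] sum.reindex[OF inj2] flag_word_shift sum_distrib_left
        nc_scalar_left_commute[of "nc_word [LA] - nc_word [LB]"] nc_scalar_left_commute[of "nc_word [LB]"]\<close>)
qed

lemma flag_gen_diff: "flag_gen d (\<lambda>T. f T - g T) = flag_gen d f - flag_gen d g"
  by (simp add: flag_gen_def nc_scalar_diff left_diff_distrib sum_subtractf)

lemma flag_gen_sum: "flag_gen d (\<lambda>T. \<Sum>x\<in>S. f x T) = (\<Sum>x\<in>S. flag_gen d (f x))"
proof -
  have "flag_gen d (\<lambda>T. \<Sum>x\<in>S. f x T) = (\<Sum>T\<in>Pow {..<d}. \<Sum>x\<in>S. nc_scalar (f x T) * flag_word d T)"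
    by (simp add: flag_gen_def nc_scalar_sum sum_distrib_right)
  also have "\<dots> = (\<Sum>x\<in>S. flag_gen d (f x))"
    unfolding flag_gen_def by (rule sum.swap)
  finally show ?thesis .
qed

lemma flag_gen_cmult: "flag_gen d (\<lambda>T. q * f T) = nc_scalar q * flag_gen d f"
  by (simp add: flag_gen_def nc_scalar_mult sum_distrib_left mult.assoc)

lemma flag_gen_cong: "(\<And>T. T \<subseteq> {..<d} \<Longrightarrow> f T = g T) \<Longrightarrow> flag_gen d f = flag_gen d g"
  unfolding flag_gen_def by (rule sum.cong) auto

lemma flag_gen_zero [simp]: "flag_gen d (\<lambda>T. 0) = 0"
  by (simp add: flag_gen_def)

text \<open>Multiplying out, each factor a - b yields a or -b. The word of \<open>S\<close> arises
  by picking -b exactly at the positions in \<open>S - T\<close>, which gives the sign. The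
  induction peels off the last letter.\<close>

lemma flag_word_expand:
  assumes "T \<subseteq> {..<d}"
  shows "flag_word d T =
    (\<Sum>S\<in>Pow {..<d}. nc_scalar (if T \<subseteq> S then (-1) ^ (card S - card T) else 0) * nc_word (ab_word d S))"
  using assms
proof (induction d arbitrary: T)
  case 0
  then show ?case
    by (simp add: flag_word_def ab_word_def)
next
  case (Suc d)
  let ?g = "\<lambda>T S. if T \<subseteq> S then (-1) ^ (card S - card T) else (0 :: rat)"
  let ?a = "nc_word [LA]" and ?b = "nc_word [LB]"
  let ?U = "T - {d}"
  have U: "?U \<subseteq> {..<d}"
    using Suc.prems by auto
  have fin: "finite S" if "S \<subseteq> {..<d}" for S
    using that finite_subset by blast
  have inj: "inj_on (insert d) (Pow {..<d})"
    by (auto simp: inj_on_def insert_eq_iff)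
  have word: "nc_word (ab_word (Suc d) (insert d S)) = nc_word (ab_word d S) * ?b"
      "nc_word (ab_word (Suc d) S) = nc_word (ab_word d S) * ?a" if "S \<subseteq> {..<d}" for S
  proof -
    have "ab_word d (insert d S) = ab_word d S"
      by (rule ab_word_cong) auto
    moreover have "d \<notin> S" using that by auto
    ultimately show "nc_word (ab_word (Suc d) (insert d S)) = nc_word (ab_word d S) * ?b"
      "nc_word (ab_word (Suc d) S) = nc_word (ab_word d S) * ?a"
      by (simp_all add: ab_word_Suc)
  qed
  have "(\<Sum>S\<in>Pow {..<Suc d}. nc_scalar (?g T S) * nc_word (ab_word (Suc d) S)) =
      (\<Sum>S\<in>Pow {..<d}. nc_scalar (?g T S) * (nc_word (ab_word d S) * ?a)) +
      (\<Sum>S\<in>Pow {..<d}. nc_scalar (?g T (insert d S)) * (nc_word (ab_word d S) * ?b))"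
    unfolding Pow_lessThan_Suc
    by (subst sum.union_disjoint) (auto simp: sum.reindex[OF inj] word)
  also have "\<dots> = flag_word d ?U * (if d \<in> T then ?b else ?a - ?b)"
  proof (cases "d \<in> T")
    case True
    have "?g T S = 0" "?g T (insert d S) = ?g ?U S" if "S \<subseteq> {..<d}" for S
    proof -
      have "d \<notin> S" using that by auto
      moreover have "card T = Suc (card ?U)"
        by (metis True Suc.prems finite_subset finite_lessThan card_Suc_Diff1)
      ultimately show "?g T S = 0" "?g T (insert d S) = ?g ?U S"
        using True by (auto simp: card_insert_disjoint[OF fin[OF that]])
    qed
    then show ?thesis
      by (simp add: True Suc.IH[OF U] sum_distrib_right mult.assoc cong: if_cong)
  next
    case False
    \<comment> \<open>Adding \<open>d\<close> raises the cardinality of \<open>S\<close> by one,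
      which accounts for the minus sign in the last factor a - b.\<close>
    have "?g T (insert d S) = - ?g T S" if "S \<subseteq> {..<d}" for S
    proof (cases "T \<subseteq> S")
      case True
      moreover have "d \<notin> S" using that by auto
      moreover have "card T \<le> card S"
        using True fin[OF that] card_mono by blast
      ultimately show ?thesis
        using fin[OF that] by (auto simp: Suc_diff_le)
    qed (use False in auto)
    moreover have "flag_word d T = (\<Sum>S\<in>Pow {..<d}. nc_scalar (?g T S) * nc_word (ab_word d S))"
      using U False by (intro Suc.IH) simp
    ultimately show ?thesis
      using False 
      by (simp add: right_diff_distrib sum_distrib_right mult.assoc sum_negf nc_scalar_uminus cong: if_cong)
  qed
  also have "flag_word d ?U = flag_word d T"
    by (rule flag_word_cong) auto
  finally show ?case
    by (simp add: flag_word_Suc)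
qed

lemma ab_index_eq_flag_gen:
  "ab_index P = flag_gen (nat (aff_dim P)) (\<lambda>T. of_nat (flag_f P T))"
proof -
  let ?d = "nat (aff_dim P)"
  let ?f = "\<lambda>T. of_nat (flag_f P T) :: rat"
  let ?g = "\<lambda>T S. if T \<subseteq> S then (-1) ^ (card S - card T) else (0 :: rat)"
  \<comment> \<open>Zero terms extend the sum from the subsets of \<open>S\<close> to all subsets,
    so that the two summation ranges become independent and can be swapped.\<close>
  have h: "flag_h P S = (\<Sum>T\<in>Pow {..<?d}. ?f T * ?g T S)" if "S \<subseteq> {..<?d}" for S
    unfolding flag_h_def
    by (rule sum.mono_neutral_cong_left) (use that in auto)
  have "ab_index P =
      (\<Sum>S\<in>Pow {..<?d}. \<Sum>T\<in>Pow {..<?d}. nc_scalar (?f T) * (nc_scalar (?g T S) * nc_word (ab_word ?d S)))"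
    unfolding ab_index_def Let_def
    by (rule sum.cong) (auto simp: h nc_scalar_sum nc_scalar_mult sum_distrib_right mult.assoc)
  also have "\<dots> = (\<Sum>T\<in>Pow {..<?d}. nc_scalar (?f T) * flag_word ?d T)"
    by (subst sum.swap) (simp add: flag_word_expand sum_distrib_left)
  finally show ?thesis
    by (simp add: flag_gen_def)
qed

subsection \<open>Hyperplane sections of polytopes\<close>

lemma mem_vert_face: "F face_of P \<Longrightarrow> v \<in> vert F \<longleftrightarrow> v \<in> vert P \<and> v \<in> F"
  by (simp add: vert_def extreme_point_of_face)

lemma finite_vert: "polytope P \<Longrightarrow> finite (vert P)"
  by (simp add: vert_def finite_polyhedron_extreme_points polytope_imp_polyhedron)

lemma polytope_eq_hull_vert:
  fixes P :: "'a::euclidean_space set"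
  shows "polytope P \<Longrightarrow> P = convex hull (vert P)"
  unfolding vert_def by (intro Krein_Milman_Minkowski polytope_imp_compact polytope_imp_convex)

lemma vert_nonempty:
  fixes P :: "'a::euclidean_space set"
  shows "polytope P \<Longrightarrow> P \<noteq> {} \<Longrightarrow> vert P \<noteq> {}"
  using polytope_eq_hull_vert by fastforce

lemma vert_subset: "vert P \<subseteq> P"
  by (auto simp: vert_def extreme_point_of_def)

lemma polytope_subset_convexI:
  fixes P :: "'a::euclidean_space set"
  assumes "polytope P" "convex C" "vert P \<subseteq> C"
  shows "P \<subseteq> C"
  using polytope_eq_hull_vert[OF assms(1)] hull_minimal[of "vert P" C convex] assms(2,3) by auto

lemma polytope_single_vertex:
  fixes P :: "'a::euclidean_space set"
  assumes "polytope P" "vert P \<subseteq> {v}"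
  shows "P \<subseteq> {v}"
  using polytope_subset_convexI[OF assms(1) convex_singleton assms(2)] .

text \<open>Take an inclusion-minimal face through x. Were x on its relative boundary, some facet of
  that face would contain x and contradict minimality.\<close>

lemma polytope_face_containing_rel_interior:
  fixes P :: "'a::euclidean_space set"
  assumes "polytope P" "x \<in> P"
  obtains F where "F face_of P" "x \<in> rel_interior F"
proof -
  define A where "A = {F. F face_of P \<and> x \<in> F}"
  have "finite A"
    unfolding A_def using finite_polytope_faces[OF assms(1)] by (rule rev_finite_subset) auto
  moreover have "P \<in> A"
    using assms by (simp add: A_def face_of_refl polytope_imp_convex)
  ultimately obtain F where F: "F \<in> A" and min: "\<And>G. G \<in> A \<Longrightarrow> G \<subseteq> F \<Longrightarrow> G = F"
    using finite_has_minimal[of A] by (metis empty_iff)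
  have "polyhedron F"
    using F assms(1) face_of_polytope_polytope polytope_imp_polyhedron by (auto simp: A_def)
  have "x \<in> rel_interior F"
  proof (rule ccontr)
    assume "x \<notin> rel_interior F"
    then obtain G where "G facet_of F" "x \<in> G"
      using F rel_boundary_of_polyhedron[OF \<open>polyhedron F\<close>] by (auto simp: A_def)
    then have "G face_of F" "G \<noteq> F"
      by (auto simp: facet_of_def)
    moreover from this have "G \<in> A"
      using F \<open>x \<in> G\<close> face_of_trans by (auto simp: A_def)
    ultimately show False
      using min face_of_imp_subset by blast
  qed
  then show ?thesis
    using that F by (auto simp: A_def)
qed

text \<open>If F lay on one closed side of the hyperplane, the section would be a nonempty face of
  F, and a vertex of it would be a vertex of F on the hyperplane. So F has points strictly on both
  sides, hence so does its relative interior, which is connected.\<close>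

lemma rel_interior_Int_hyperplane_nonempty:
  fixes F :: "'a::euclidean_space set"
  assumes F: "polytope F" and avoid: "\<And>u. u \<in> vert F \<Longrightarrow> a \<bullet> u \<noteq> c"
    and ne: "F \<inter> {x. a \<bullet> x = c} \<noteq> {}"
  shows "rel_interior F \<inter> {x. a \<bullet> x = c} \<noteq> {}"
proof -
  have cvx: "convex F"
    using F polytope_imp_convex by blast
  have supp: "\<not> (F \<inter> {x. a \<bullet> x = c}) face_of F"
  proof
    assume face: "(F \<inter> {x. a \<bullet> x = c}) face_of F"
    then obtain u where "u \<in> vert (F \<inter> {x. a \<bullet> x = c})"
      using F ne face_of_polytope_polytope vert_nonempty by blast
    then show False
      using avoid mem_vert_face[OF face] by auto
  qed
  \<comment> \<open>The relative interior is dense in F.\<close>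
  have side: "\<exists>x\<in>rel_interior F. x \<in> U" if "open U" "F \<inter> U \<noteq> {}" for U
  proof -
    have "U \<inter> closure (rel_interior F) \<noteq> {}"
      using that(2) closure_subset convex_closure_rel_interior[OF cvx] by blast
    then show ?thesis
      using open_Int_closure_eq_empty[OF that(1)] by blast
  qed
  have "F \<inter> {x. a \<bullet> x < c} \<noteq> {}"
    using supp face_of_Int_supporting_hyperplane_ge[OF cvx, where a = a and b = c] by force
  then obtain x where "x \<in> rel_interior F" "a \<bullet> x < c"
    using side[OF open_halfspace_lt] by blast
  moreover have "F \<inter> {x. a \<bullet> x > c} \<noteq> {}"
    using supp face_of_Int_supporting_hyperplane_le[OF cvx, where a = a and b = c] by force
  then obtain y where "y \<in> rel_interior F" "a \<bullet> y > c"
    using side[OF open_halfspace_gt] by blast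
  moreover have "connected (rel_interior F)"
    by (simp add: convex_connected convex_rel_interior cvx)
  ultimately show ?thesis
    using connected_ivt_hyperplane[of "rel_interior F" x y a c] by force
qed

text \<open>A hyperplane missing all vertices cuts every face it meets through its relative
  interior. The locale is used twice: for the vertex figure as a section of P, and for the sweep
  hyperplane as it cuts that figure.\<close>

locale polytope_section =
  fixes X :: "'a::euclidean_space set" and a :: 'a and c :: real and H :: "'a set"
  assumes polytope: "polytope X"
    and avoids_vert: "\<And>u. u \<in> vert X \<Longrightarrow> a \<bullet> u \<noteq> c"
    and H_def: "H = {x. a \<bullet> x = c}"
begin

lemma polytope_section: "polytope (X \<inter> H)"
  unfolding H_def by (intro polytope_Int_polyhedron polytope polyhedron_hyperplane)

lemma affine_H: "affine H"
  by (simp add: H_def affine_hyperplane)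

lemma face_rel_interior_meets:
  assumes "F face_of X" "F \<inter> H \<noteq> {}"
  shows "rel_interior F \<inter> H \<noteq> {}"
proof -
  have "polytope F"
    using assms(1) polytope face_of_polytope_polytope by blast
  moreover have "a \<bullet> u \<noteq> c" if "u \<in> vert F" for u
    using that avoids_vert mem_vert_face[OF assms(1)] by blast
  ultimately show ?thesis
    using assms(2) rel_interior_Int_hyperplane_nonempty unfolding H_def by blast
qed

section \<open>Faces and flags of a hyperplane section\<close>

lemma face_section: "F face_of X \<Longrightarrow> (F \<inter> H) face_of (X \<inter> H)"
  by (intro face_of_slice affine_imp_convex affine_H)

text \<open>A face that meets the relative interior of \<open>F\<close> contains \<open>F\<close>,
  and the points of \<open>F\<close> on the hyperplane include relative interior ones.\<close>

lemma section_subset_imp_subset: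
  assumes "F face_of X" "F \<inter> H \<noteq> {}" "G face_of X" "F \<inter> H \<subseteq> G"
  shows "F \<subseteq> G"
proof (rule subset_of_face_of[OF assms(3)])
  show "F \<subseteq> X"
    using assms(1) face_of_imp_subset by blast
  show "G \<inter> rel_interior F \<noteq> {}"
    using face_rel_interior_meets[OF assms(1,2)] assms(4) rel_interior_subset by blast
qed

lemma section_eq_imp_eq:
  assumes "F face_of X" "F \<inter> H \<noteq> {}" "G face_of X" "F \<inter> H = G \<inter> H"
  shows "F = G"
  using section_subset_imp_subset[of F G] section_subset_imp_subset[of G F] assms by blast

text \<open>Choose x in the relative interior of K and let F be the face of X with x in its relative
  interior. Then x is also relatively interior to \<open>F \<inter> H\<close>, and faces of the
  section sharing such a point contain each other.\<close>

lemma section_face_obtains: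
  assumes "K face_of (X \<inter> H)" "K \<noteq> {}"
  obtains F where "F face_of X" "K = F \<inter> H"
proof -
  have "convex K"
    using assms(1) face_of_imp_convex by blast
  then obtain x where x: "x \<in> rel_interior K"
    using assms(2) rel_interior_eq_empty by blast
  have "K \<subseteq> X \<inter> H"
    using assms(1) face_of_imp_subset by blast
  then have "x \<in> X" "x \<in> H"
    using x rel_interior_subset by blast+
  obtain F where F: "F face_of X" "x \<in> rel_interior F"
    using polytope_face_containing_rel_interior[OF polytope \<open>x \<in> X\<close>] by blast
  have "K \<subseteq> F"
    by (rule subset_of_face_of[OF F(1)])
      (use F(2) x rel_interior_subset \<open>K \<subseteq> X \<inter> H\<close> in blast)+
  moreover have "F \<inter> H \<subseteq> K"
  proof (rule subset_of_face_of[OF assms(1)])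
    show "F \<inter> H \<subseteq> X \<inter> H"
      using F(1) face_of_imp_subset by blast
    have "rel_interior (F \<inter> H) = rel_interior F \<inter> H"
      by (rule convex_affine_rel_interior_Int)
        (use F \<open>x \<in> H\<close> affine_H face_of_imp_convex in auto)
    then show "K \<inter> rel_interior (F \<inter> H) \<noteq> {}"
      using F(2) x \<open>x \<in> H\<close> rel_interior_subset by blast
  qed
  ultimately show ?thesis
    using that[OF F(1)] \<open>K \<subseteq> X \<inter> H\<close> by blast
qed

text \<open>The relative interior is open in the affine hull, so the section has the dimension of
  the hull cut by the hyperplane. The cut loses exactly one dimension because a vertex of F lies off
  the hyperplane.\<close>

lemma aff_dim_section:
  assumes "F face_of X" "F \<inter> H \<noteq> {}"
  shows "aff_dim (F \<inter> H) = aff_dim F - 1"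
proof -
  obtain U where U: "open U" "rel_interior F = affine hull F \<inter> U"
    using openin_rel_interior[of F] by (auto simp: openin_open)
  have "convex (affine hull F \<inter> H)"
    by (intro affine_imp_convex affine_Int affine_affine_hull affine_H)
  moreover have "(affine hull F \<inter> H) \<inter> U = rel_interior F \<inter> H"
    using U(2) by auto
  ultimately have "aff_dim (rel_interior F \<inter> H) = aff_dim (affine hull F \<inter> H)"
    using aff_dim_convex_Int_open[of "affine hull F \<inter> H" U] U(1) face_rel_interior_meets[OF assms]
    by auto
  moreover have "aff_dim (rel_interior F \<inter> H) \<le> aff_dim (F \<inter> H)"
    by (rule aff_dim_subset) (use rel_interior_subset in blast)
  moreover have "aff_dim (F \<inter> H) \<le> aff_dim (affine hull F \<inter> H)"
    by (rule aff_dim_subset) (auto intro: hull_inc)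
  moreover have "aff_dim (affine hull F \<inter> H) = aff_dim F - 1"
  proof -
    obtain u where "u \<in> vert F"
      using assms polytope face_of_polytope_polytope vert_nonempty by blast
    then have "u \<in> affine hull F" "a \<bullet> u \<noteq> c"
      using mem_vert_face[OF assms(1), of u] avoids_vert vert_subset[of F] by (auto intro: hull_inc)
    then have "\<not> affine hull F \<subseteq> {x. a \<bullet> x = c}"
      by blast
    moreover have "affine hull F \<inter> {x. a \<bullet> x = c} \<noteq> {}"
      using assms(2) by (auto simp: H_def intro: hull_inc)
    ultimately show ?thesis
      by (simp add: H_def aff_dim_affine_Int_hyperplane affine_affine_hull)
  qed
  ultimately show ?thesis
    by simp
qed

text \<open>Cutting is an inclusion-preserving and inclusion-reflecting bijection from the faces met
  by the hyperplane to the nonempty faces of the section. It lowers dimensions by one, hence the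
  shift by \<open>Suc\<close>.\<close>

lemma bij_betw_flag_chains_section:
  "bij_betw (\<lambda>F. \<lambda>t\<in>T. F (Suc t) \<inter> H)
     {F \<in> flag_chains X (Suc ` T). \<forall>t\<in>T. F (Suc t) \<inter> H \<noteq> {}} (flag_chains (X \<inter> H) T)"
  (is "bij_betw ?s ?C _")
  unfolding bij_betw_def
proof (intro conjI equalityI subsetI)
  have faceD: "F (Suc t) face_of X" "aff_dim (F (Suc t)) = 1 + int t" "F (Suc t) \<inter> H \<noteq> {}"
    if "F \<in> ?C" "t \<in> T" for F t
    using that by (auto simp: flag_chains_def PiE_iff)
  show "inj_on ?s ?C"
  proof (rule inj_onI)
    fix F G assume F: "F \<in> ?C" and G: "G \<in> ?C" and eq: "?s F = ?s G"
    have fg: "F (Suc t) = G (Suc t)" if "t \<in> T" for t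
      using section_eq_imp_eq faceD[OF F that] faceD[OF G that] fun_cong[OF eq, of t] that by simp
    have "F s = G s" for s
      using F G fg by (cases "s \<in> Suc ` T") (auto simp: flag_chains_def PiE_def extensional_def)
    then show "F = G" ..
  qed
  show "K \<in> flag_chains (X \<inter> H) T" if mem: "K \<in> ?s ` ?C" for K
  proof -
    obtain F where F: "F \<in> ?C" and K: "K = ?s F"
      using mem by (rule imageE)
    have "strict_mono_on T K"
    proof (rule strict_mono_onI)
      fix s t assume st: "s \<in> T" "t \<in> T" "s < t"
      then have "F (Suc s) \<subset> F (Suc t)"
        using F by (auto simp: flag_chains_def strict_mono_on_def)
      moreover from this have "F (Suc s) \<inter> H \<noteq> F (Suc t) \<inter> H"
        using section_eq_imp_eq[OF faceD(1,3)[OF F st(1)] faceD(1)[OF F st(2)]] by blast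
      ultimately show "K s < K t"
        using st by (auto simp: K)
    qed
    then show ?thesis
      using faceD[OF F] by (auto simp: flag_chains_def K PiE_iff face_section aff_dim_section)
  qed
  show "K \<in> ?s ` ?C" if K: "K \<in> flag_chains (X \<inter> H) T" for K
  proof -
    have "\<exists>F. F face_of X \<and> K t = F \<inter> H" if "t \<in> T" for t
    proof -
      have "K t face_of (X \<inter> H)" "aff_dim (K t) = int t"
        using K that by (auto simp: flag_chains_def PiE_iff)
      moreover from this have "K t \<noteq> {}"
        by auto
      ultimately show ?thesis
        using section_face_obtains by blast
    qed
    then obtain \<Phi> where \<Phi>: "\<And>t. t \<in> T \<Longrightarrow> \<Phi> t face_of X" "\<And>t. t \<in> T \<Longrightarrow> K t = \<Phi> t \<inter> H"
      by metis
    have K': "aff_dim (K t) = int t" if "t \<in> T" for t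
      using K that by (auto simp: flag_chains_def PiE_iff)
    then have ne: "\<Phi> t \<inter> H \<noteq> {}" if "t \<in> T" for t
      using \<Phi>(2)[OF that] that by force
    have dim: "aff_dim (\<Phi> t) = 1 + int t" if "t \<in> T" for t
      using aff_dim_section[OF \<Phi>(1) ne] K' \<Phi>(2) that by force
    \<comment> \<open>The subtraction undoes the shift by \<open>Suc\<close>; the restriction keeps
      \<open>F\<close> extensional, as flags are required to be.\<close>
    define F where "F = (\<lambda>s\<in>Suc ` T. \<Phi> (s - 1))"
    have F: "F (Suc t) = \<Phi> t" if "t \<in> T" for t
      using that by (simp add: F_def)
    have "strict_mono_on (Suc ` T) F"
    proof (rule strict_mono_onI)
      fix s' t' assume "s' \<in> Suc ` T" "t' \<in> Suc ` T" "s' < t'"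
      then obtain s t where st: "s \<in> T" "t \<in> T" "s < t" "s' = Suc s" "t' = Suc t"
        by auto
      have "K s < K t"
        using K st by (simp add: flag_chains_def strict_mono_on_def)
      then have "\<Phi> s \<inter> H \<subset> \<Phi> t \<inter> H"
        using \<Phi>(2) st by simp
      then show "F s' < F t'"
        using section_subset_imp_subset[OF \<Phi>(1) ne \<Phi>(1)] st F by blast
    qed
    then have "F \<in> ?C"
      using F ne by (auto simp: flag_chains_def F_def \<Phi>(1) dim)
    moreover have "?s F = K"
    proof
      show "?s F t = K t" for t
        using K F \<Phi>(2) by (cases "t \<in> T") (auto simp: flag_chains_def PiE_iff extensional_def)
    qed
    ultimately show ?thesis
      by blast
  qed
qed

text \<open>The predicate \<open>\<phi>\<close> allows the same bijection to count all flags of a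
  section, or only those whose members meet a further hyperplane.\<close>

lemma card_flag_chains_section:
  "card {K \<in> flag_chains (X \<inter> H) T. \<forall>t\<in>T. \<phi> (K t)} =
   card {F \<in> flag_chains X (Suc ` T). \<forall>t\<in>T. F (Suc t) \<inter> H \<noteq> {} \<and> \<phi> (F (Suc t) \<inter> H)}"
proof -
  have bij: "bij_betw (\<lambda>F. \<lambda>t\<in>T. F (Suc t) \<inter> H)
     {F \<in> {F \<in> flag_chains X (Suc ` T). \<forall>t\<in>T. F (Suc t) \<inter> H \<noteq> {}}. \<forall>t\<in>T. \<phi> (F (Suc t) \<inter> H)}
     {K \<in> flag_chains (X \<inter> H) T. \<forall>t\<in>T. \<phi> (K t)}"
    by (rule bij_betw_Collect[OF bij_betw_flag_chains_section]) auto
  have eq: "{F \<in> {F \<in> flag_chains X (Suc ` T). \<forall>t\<in>T. F (Suc t) \<inter> H \<noteq> {}}.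
        \<forall>t\<in>T. \<phi> (F (Suc t) \<inter> H)} =
      {F \<in> flag_chains X (Suc ` T). \<forall>t\<in>T. F (Suc t) \<inter> H \<noteq> {} \<and> \<phi> (F (Suc t) \<inter> H)}"
    by blast
  show ?thesis
    using bij_betw_same_card[OF bij] unfolding eq by (rule sym)
qed

end

subsection \<open>Vertex figures and the sweep\<close>

definition extremal :: "'a::real_inner \<Rightarrow> 'a \<Rightarrow> 'a set \<Rightarrow> bool" where
  "extremal p v F \<longleftrightarrow> (\<forall>x\<in>F. p \<bullet> v \<le> p \<bullet> x) \<or> (\<forall>x\<in>F. p \<bullet> x \<le> p \<bullet> v)"

lemma extremal_subset: "extremal p v F \<Longrightarrow> G \<subseteq> F \<Longrightarrow> extremal p v G"
  by (auto simp: extremal_def)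

lemma other_vertex:
  fixes F :: "'a::euclidean_space set"
  assumes "polytope F" "1 \<le> aff_dim F"
  obtains u where "u \<in> vert F" "u \<noteq> v"
proof -
  have "\<not> vert F \<subseteq> {v}"
  proof
    assume "vert F \<subseteq> {v}"
    then have "F \<subseteq> {v}"
      by (rule polytope_single_vertex[OF assms(1)])
    then show False
      using aff_dim_subset[of F "{v}"] assms(2) by simp
  qed
  then show ?thesis
    using that by blast
qed

lemma vertex_below:
  fixes F :: "'a::euclidean_space set"
  assumes "polytope F" "x \<in> F" "p \<bullet> x < c"
  obtains u where "u \<in> vert F" "p \<bullet> u < c"
  using polytope_subset_convexI[OF assms(1) convex_halfspace_ge[where a = p and b = c]] assms(2,3) by fastforce

text \<open>Minimum and maximum of a linear functional on a polytope are attained at vertices.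
  Injectivity makes each of the two vertices unique, and positive dimension makes them
  different.\<close>

lemma card_extremal_vert:
  fixes F :: "'a::euclidean_space set"
  assumes F: "polytope F" "1 \<le> aff_dim F" and inj: "inj_on (\<lambda>x. p \<bullet> x) (vert F)"
  shows "card {v \<in> vert F. extremal p v F} = 2"
proof -
  have ne: "vert F \<noteq> {}" "finite (vert F)"
    using other_vertex[OF F] finite_vert[OF F(1)] by blast+
  obtain m where m: "m \<in> vert F" "\<And>u. u \<in> vert F \<Longrightarrow> p \<bullet> m \<le> p \<bullet> u"
    using arg_min_if_finite[OF ne(2,1), of "\<lambda>x. p \<bullet> x"] by (metis not_less)
  obtain M where M: "M \<in> vert F" "\<And>u. u \<in> vert F \<Longrightarrow> p \<bullet> u \<le> p \<bullet> M"
    using arg_min_if_finite[OF ne(2,1), of "\<lambda>x. - (p \<bullet> x)"] by (metis not_less neg_less_iff_less)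
  obtain u where "u \<in> vert F" "u \<noteq> m"
    using other_vertex[OF F] by blast
  then have "m \<noteq> M"
    using m M inj by (metis antisym inj_on_def)
  have lower: "p \<bullet> m \<le> p \<bullet> x" if "x \<in> F" for x
    using polytope_subset_convexI[OF F(1) convex_halfspace_ge[where a = p and b = "p \<bullet> m"]] m(2) that by fastforce
  have upper: "p \<bullet> x \<le> p \<bullet> M" if "x \<in> F" for x
    using polytope_subset_convexI[OF F(1) convex_halfspace_le[where a = p and b = "p \<bullet> M"]] M(2) that by fastforce
  have "{v \<in> vert F. extremal p v F} = {m, M}"
  proof (intro equalityI subsetI)
    fix v assume "v \<in> {v \<in> vert F. extremal p v F}"
    then have v: "v \<in> vert F" "extremal p v F"
      by auto
    then have "p \<bullet> v \<le> p \<bullet> m \<or> p \<bullet> M \<le> p \<bullet> v"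
      using m(1) M(1) vert_subset by (auto simp: extremal_def)
    then have "p \<bullet> v = p \<bullet> m \<or> p \<bullet> v = p \<bullet> M"
      using m(2) M(2) v(1) by (meson antisym)
    then show "v \<in> {m, M}"
      using inj v(1) m(1) M(1) by (auto simp: inj_on_def)
  qed (use m(1) M(1) lower upper in \<open>auto simp: extremal_def\<close>)
  then show ?thesis
    using \<open>m \<noteq> M\<close> by simp
qed

text \<open>Faces of a polyhedron are exposed, so a vertex has a supporting hyperplane touching only
  there; finiteness of the vertex set then leaves room to push it in.\<close>

lemma vertex_figure_exists:
  fixes P :: "'a::euclidean_space set"
  assumes P: "polytope P" "1 \<le> aff_dim P" and v: "v \<in> vert P"
  obtains Q where "is_vertex_figure P v Q"
proof -
  have "{v} exposed_face_of P"
    using v P(1) by (simp add: exposed_face_of_polyhedron polytope_imp_polyhedron face_of_singleton vert_def)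
  then obtain a b where ab: "P \<subseteq> {x. a \<bullet> x \<le> b}" "{v} = P \<inter> {x. a \<bullet> x = b}"
    by (auto simp: exposed_face_of_def)
  have "a \<noteq> 0"
  proof
    assume "a = 0"
    then have "P = {v}"
      using ab by (cases "b = 0") auto
    then show False
      using P(2) by simp
  qed
  have below: "a \<bullet> u < b" if "u \<in> vert P - {v}" for u
  proof -
    have "u \<in> P" "u \<noteq> v"
      using that vert_subset by auto
    then show ?thesis
      using ab by (metis (mono_tags) Int_iff mem_Collect_eq order_le_less singletonD subsetD)
  qed
  \<comment> \<open>Half the least gap between b and the values at the other vertices; the inserted
    2 guarantees that \<open>Min\<close> is taken over a nonempty set.\<close>
  define e where "e = Min (insert 2 ((\<lambda>u. b - a \<bullet> u) ` (vert P - {v}))) / 2"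
  let ?M = "insert 2 ((\<lambda>u. b - a \<bullet> u) ` (vert P - {v}))"
  have fin: "finite ?M"
    using finite_vert[OF P(1)] by simp
  have "0 < Min ?M"
    using below by (subst Min_gr_iff[OF fin]) auto
  then have "0 < e"
    by (simp add: e_def)
  have "a \<bullet> u < b - e" if "u \<in> vert P - {v}" for u
  proof -
    have "Min ?M \<le> b - a \<bullet> u"
      by (rule Min_le[OF fin]) (use that in auto)
    then show ?thesis
      using \<open>0 < Min ?M\<close> by (simp add: e_def)
  qed
  then have "is_vertex_figure P v (P \<inter> {x. a \<bullet> x = b - e})"
    unfolding is_vertex_figure_def
    using ab \<open>a \<noteq> 0\<close> \<open>0 < e\<close> by blast
  then show ?thesis
    using that by blast
qed

text \<open>Up to a dimension shift this counts flags of \<open>R_v\<close>, but for empty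
  \<open>T\<close> its value is 1 even if \<open>R_v\<close> is empty. Hence the case distinctions
  on emptiness below.\<close>

definition level_count :: "'a::euclidean_space set \<Rightarrow> 'a \<Rightarrow> 'a \<Rightarrow> nat set \<Rightarrow> nat" where
  "level_count Q p v T = card {K \<in> flag_chains Q T. \<forall>t\<in>T. K t \<inter> sweep_hyperplane p v \<noteq> {}}"

text \<open>Of the vertex figure only a hyperplane \<open>H\<close> separating v strictly from all
  other vertices is retained.\<close>

locale swept_vertex =
  fixes P :: "'a::euclidean_space set" and p v a :: 'a and \<beta> :: real and Q H :: "'a set"
  assumes P: "polytope P" "1 \<le> aff_dim P"
    and inj: "inj_on (\<lambda>x. p \<bullet> x) (vert P)"
    and v: "v \<in> vert P"
    and below: "\<And>u. u \<in> vert P \<Longrightarrow> u \<noteq> v \<Longrightarrow> a \<bullet> u < \<beta>"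
    and above: "\<beta> < a \<bullet> v"
    and H_def: "H = {x. a \<bullet> x = \<beta>}"
    and Q_eq: "Q = P \<inter> H"
begin

sublocale figure: polytope_section P a \<beta> H
proof
  show "a \<bullet> u \<noteq> \<beta>" if "u \<in> vert P" for u
    using that below[of u] above by (cases "u = v") auto
qed (simp_all add: P H_def)

lemma polytope_Q: "polytope Q"
  using figure.polytope_section by (simp add: Q_eq)

text \<open>A face avoiding v has all its vertices strictly below \<open>H\<close>. A face of
  positive dimension through v has another vertex, so it reaches both sides.\<close>

lemma face_meets_H_iff:
  assumes F: "F face_of P" "1 \<le> aff_dim F"
  shows "F \<inter> H \<noteq> {} \<longleftrightarrow> v \<in> F"
proof
  have pF: "polytope F"
    using F(1) P(1) face_of_polytope_polytope by blast
  show "v \<in> F" if "F \<inter> H \<noteq> {}"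
  proof (rule ccontr)
    assume "v \<notin> F"
    then have "vert F \<subseteq> {x. a \<bullet> x < \<beta>}"
      using below mem_vert_face[OF F(1)] by blast
    then have "F \<subseteq> {x. a \<bullet> x < \<beta>}"
      by (rule polytope_subset_convexI[OF pF convex_halfspace_lt])
    then show False
      using that by (auto simp: H_def)
  qed
  show "F \<inter> H \<noteq> {}" if vF: "v \<in> F"
  proof -
    obtain u where "u \<in> vert F" "u \<noteq> v"
      using other_vertex[OF pF F(2)] by blast
    then have "u \<in> F" "a \<bullet> u < \<beta>"
      using below mem_vert_face[OF F(1)] by auto
    then obtain z where "z \<in> F" "a \<bullet> z = \<beta>"
      using connected_ivt_hyperplane[of F u v a \<beta>] vF above pF
      by (auto simp: convex_connected polytope_imp_convex)
    then show ?thesis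
      by (auto simp: H_def)
  qed
qed

lemma aff_dim_Q: "aff_dim Q = aff_dim P - 1"
proof -
  have face: "P face_of P"
    using P(1) face_of_refl polytope_imp_convex by blast
  moreover have "P \<inter> H \<noteq> {}"
    using face_meets_H_iff[OF face P(2)] v vert_subset by blast
  ultimately show ?thesis
    using figure.aff_dim_section by (simp add: Q_eq)
qed

text \<open>Genericity makes \<open>v\<close> the only point of \<open>F\<close> at its level if it is extremal on \<open>F\<close>.\<close>

lemma section_meets_sweep_iff:
  assumes F: "F face_of P" "v \<in> F"
  shows "F \<inter> H \<inter> sweep_hyperplane p v \<noteq> {} \<longleftrightarrow> \<not> extremal p v F"
proof
  have pF: "polytope F" and cF: "convex F"
    using F(1) P(1) face_of_polytope_polytope polytope_imp_convex by blast+
  show "\<not> extremal p v F" if "F \<inter> H \<inter> sweep_hyperplane p v \<noteq> {}"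
  proof
    assume "extremal p v F"
    then have face: "(F \<inter> {x. p \<bullet> x = p \<bullet> v}) face_of F"
      unfolding extremal_def
      using face_of_Int_supporting_hyperplane_ge[OF cF, where a = p and b = "p \<bullet> v"]
        face_of_Int_supporting_hyperplane_le[OF cF, where a = p and b = "p \<bullet> v"] by force
    have "vert (F \<inter> {x. p \<bullet> x = p \<bullet> v}) \<subseteq> {v}"
      using inj v by (auto simp: mem_vert_face[OF face] mem_vert_face[OF F(1)] inj_on_def)
    then have "F \<inter> {x. p \<bullet> x = p \<bullet> v} \<subseteq> {v}"
      by (rule polytope_single_vertex[OF face_of_polytope_polytope[OF pF face]])
    then have "v \<in> H"
      using that by (auto simp: sweep_hyperplane_def)
    then show False
      using above by (simp add: H_def)
  qed
  \<comment> \<open>The segment from u to v crosses \<open>H\<close> at a point y \<noteq> v, so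
    \<open>p \<bullet> y - p \<bullet> v\<close> is a positive multiple of
    \<open>p \<bullet> u - p \<bullet> v\<close>: y lies on the same side of the sweep hyperplane as
    u.\<close>
  have point: "\<exists>y\<in>F \<inter> H. (p \<bullet> y - p \<bullet> v) * (p \<bullet> u - p \<bullet> v) > 0" if u: "u \<in> vert F" "p \<bullet> u \<noteq> p \<bullet> v" for u
  proof -
    have u': "u \<in> F" "a \<bullet> u < \<beta>"
      using u below mem_vert_face[OF F(1)] by auto
    then obtain y where y: "y \<in> closed_segment u v" "a \<bullet> y = \<beta>"
      using connected_ivt_hyperplane[of "closed_segment u v" u v a \<beta>] above by auto
    then obtain t where t: "y = (1 - t) *\<^sub>R u + t *\<^sub>R v" "0 \<le> t" "t \<le> 1"
      by (auto simp: in_segment)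
    have "t \<noteq> 1"
      using t(1) y(2) above by auto
    then have "0 < 1 - t"
      using t(3) by simp
    moreover have "p \<bullet> y - p \<bullet> v = (1 - t) * (p \<bullet> u - p \<bullet> v)"
      unfolding t(1) by (simp add: inner_simps algebra_simps)
    moreover have "0 < (p \<bullet> u - p \<bullet> v) * (p \<bullet> u - p \<bullet> v)"
      using u(2) by (simp add: zero_less_mult_iff) linarith
    moreover have "y \<in> F"
      using y(1) u'(1) F(2) cF closed_segment_subset by blast
    ultimately show ?thesis
      using y(2) by (intro bexI[of _ y]) (simp_all add: H_def mult.assoc)
  qed
  show "F \<inter> H \<inter> sweep_hyperplane p v \<noteq> {}" if "\<not> extremal p v F"
  proof -
    obtain x x' where x: "x \<in> F" "p \<bullet> x < p \<bullet> v" "x' \<in> F" "p \<bullet> v < p \<bullet> x'"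
      using \<open>\<not> extremal p v F\<close> by (auto simp: extremal_def not_le)
    obtain u where u: "u \<in> vert F" "p \<bullet> u < p \<bullet> v"
      using vertex_below[OF pF x(1,2)] by blast
    obtain w where w: "w \<in> vert F" "p \<bullet> v < p \<bullet> w"
      using vertex_below[OF pF x(3), of "- p" "- (p \<bullet> v)"] x(4) by auto
    obtain y where y: "y \<in> F \<inter> H" "p \<bullet> y < p \<bullet> v"
      using point[OF u(1)] u(2) by (auto simp: zero_less_mult_iff)
    obtain z where z: "z \<in> F \<inter> H" "p \<bullet> v < p \<bullet> z"
      using point[OF w(1)] w(2) by (auto simp: zero_less_mult_iff)
    have "connected (F \<inter> H)"
      by (intro convex_connected convex_Int cF affine_imp_convex figure.affine_H)
    then show ?thesis
      using connected_ivt_hyperplane[of "F \<inter> H" y z p "p \<bullet> v"] y z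
      by (force simp: sweep_hyperplane_def)
  qed
qed

text \<open>A vertex of \<open>Q\<close> lies on an edge of \<open>P\<close> through \<open>v\<close>, and no edge is level.\<close>

lemma vert_Q_avoids_sweep:
  assumes x: "x \<in> vert Q"
  shows "p \<bullet> x \<noteq> p \<bullet> v"
proof
  assume level: "p \<bullet> x = p \<bullet> v"
  have "{x} face_of P \<inter> H"
    using x by (simp add: vert_def face_of_singleton Q_eq)
  then obtain F where F: "F face_of P" "{x} = F \<inter> H"
    using figure.section_face_obtains by blast
  then have dim: "aff_dim F = 1"
    using figure.aff_dim_section[OF F(1)] by (metis F(2) aff_dim_sing diff_eq_eq insert_not_empty add_0)
  have "v \<in> F"
    using face_meets_H_iff[OF F(1)] dim F(2) by auto
  have "x \<noteq> v"
    using F(2) above by (auto simp: H_def)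
  \<comment> \<open>The edge spans the line through x and v. Both are level, so the other end of the
    edge is level as well, against genericity.\<close>
  have "affine hull {x, v} = affine hull F"
  proof (rule affine_dim_equal)
    show "affine hull {x, v} \<subseteq> affine hull F"
      using F(2) \<open>v \<in> F\<close> by (intro hull_mono) auto
  qed (use dim \<open>x \<noteq> v\<close> in \<open>auto simp: affine_affine_hull\<close>)
  moreover have "affine hull {x, v} \<subseteq> {y. p \<bullet> y = p \<bullet> v}"
    by (rule hull_minimal) (use level in \<open>auto simp: affine_hyperplane\<close>)
  moreover obtain u where "u \<in> vert F" "u \<noteq> v"
    using other_vertex[of F] F(1) P(1) dim face_of_polytope_polytope by (metis order_refl)
  moreover from this have "u \<in> affine hull F" "u \<in> vert P"
    using mem_vert_face[OF F(1)] by (auto intro: hull_inc)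
  ultimately show False
    using inj v by (auto simp: inj_on_def)
qed

sublocale sweep: polytope_section Q p "p \<bullet> v" "sweep_hyperplane p v"
  by standard (simp_all add: polytope_Q vert_Q_avoids_sweep sweep_hyperplane_def)

section \<open>Flags of the vertex figure and of its sweep section\<close>

lemma flag_chainD:
  assumes "F \<in> flag_chains P (Suc ` T)" "t \<in> T"
  shows "F (Suc t) face_of P" "1 \<le> aff_dim (F (Suc t))"
  using assms by (auto simp: flag_chains_def PiE_iff)

lemma flag_f_Q: "flag_f Q T = card {F \<in> flag_chains P (Suc ` T). \<forall>t\<in>T. v \<in> F (Suc t)}"
proof -
  have "{F \<in> flag_chains P (Suc ` T). \<forall>t\<in>T. v \<in> F (Suc t)} =
      {F \<in> flag_chains P (Suc ` T). \<forall>t\<in>T. F (Suc t) \<inter> H \<noteq> {} \<and> True}"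
    using face_meets_H_iff flag_chainD by blast
  then show ?thesis
    using figure.card_flag_chains_section[of T "\<lambda>_. True"] by (simp add: flag_f_def Q_eq)
qed

lemma level_count_eq:
  "level_count Q p v T =
     card {F \<in> flag_chains P (Suc ` T). \<forall>t\<in>T. v \<in> F (Suc t) \<and> \<not> extremal p v (F (Suc t))}"
proof -
  have "{F \<in> flag_chains P (Suc ` T). \<forall>t\<in>T. v \<in> F (Suc t) \<and> \<not> extremal p v (F (Suc t))} =
     {F \<in> flag_chains P (Suc ` T). \<forall>t\<in>T. F (Suc t) \<inter> H \<noteq> {} \<and> F (Suc t) \<inter> H \<inter> sweep_hyperplane p v \<noteq> {}}"
    using face_meets_H_iff section_meets_sweep_iff flag_chainD by blast
  then show ?thesis
    using figure.card_flag_chains_section[of T "\<lambda>G. G \<inter> sweep_hyperplane p v \<noteq> {}"]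
    by (simp add: level_count_def Q_eq)
qed

lemma level_count_Suc: "level_count Q p v (Suc ` T) = flag_f (Q \<inter> sweep_hyperplane p v) T"
  using sweep.card_flag_chains_section[of T "\<lambda>_. True"]
  by (simp add: level_count_def flag_f_def)

text \<open>A 0-dimensional member of the flag would be a vertex of \<open>Q\<close> on the sweep
  hyperplane. Together with \<open>level_count_Suc\<close> this determines the count from the flags
  of \<open>R_v\<close>.\<close>

lemma level_count_zero:
  assumes "0 \<in> T"
  shows "level_count Q p v T = 0"
proof -
  have False if K: "K \<in> flag_chains Q T" "K 0 \<inter> sweep_hyperplane p v \<noteq> {}" for K
  proof -
    have "K 0 face_of Q" "aff_dim (K 0) = 0"
      using K(1) assms by (auto simp: flag_chains_def PiE_iff)
    moreover from this obtain x where "K 0 = {x}"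
      using aff_dim_eq_0 by blast
    ultimately have "x \<in> vert Q"
      by (simp add: face_of_singleton vert_def)
    then show False
      using vert_Q_avoids_sweep K(2) \<open>K 0 = {x}\<close> by (auto simp: sweep_hyperplane_def)
  qed
  then have "{K \<in> flag_chains Q T. \<forall>t\<in>T. K t \<inter> sweep_hyperplane p v \<noteq> {}} = {}"
    using assms by blast
  then show ?thesis
    by (simp only: level_count_def card.empty)
qed

lemma section_empty_iff: "Q \<inter> sweep_hyperplane p v = {} \<longleftrightarrow> extremal p v P"
  using section_meets_sweep_iff[of P] P(1) v vert_subset
  by (auto simp: Q_eq face_of_refl polytope_imp_convex)

lemma polytope_R: "polytope (Q \<inter> sweep_hyperplane p v)"
  by (rule sweep.polytope_section)

lemma aff_dim_R:
  assumes "Q \<inter> sweep_hyperplane p v \<noteq> {}"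
  shows "aff_dim (Q \<inter> sweep_hyperplane p v) = aff_dim P - 2"
  using sweep.aff_dim_section[of Q] assms aff_dim_Q polytope_Q
  by (simp add: face_of_refl polytope_imp_convex)

end

lemma swept_vertexE:
  assumes "polytope P" "1 \<le> aff_dim P" "inj_on (\<lambda>x. p \<bullet> x) (vert P)" "v \<in> vert P"
    and "is_vertex_figure P v Q"
  obtains a \<beta> where "swept_vertex P p v a \<beta> Q {x. a \<bullet> x = \<beta>}"
proof -
  obtain a b e where *: "P \<inter> {x. a \<bullet> x = b} = {v}" "0 < e" "\<forall>u\<in>vert P - {v}. a \<bullet> u < b - e"
    "Q = P \<inter> {x. a \<bullet> x = b - e}"
    using assms(5) unfolding is_vertex_figure_def by blast
  have "a \<bullet> v = b"
    using *(1) by blast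
  then have "swept_vertex P p v a (b - e) Q {x. a \<bullet> x = b - e}"
    using assms * by unfold_locales auto
  then show ?thesis
    using that by blast
qed

subsection \<open>Counting flags through vertices\<close>

lemma finite_flag_chains:
  assumes "polytope P" "finite S"
  shows "finite (flag_chains P S)"
proof (rule finite_subset)
  show "flag_chains P S \<subseteq> (\<Pi>\<^sub>E s\<in>S. {G. G face_of P})"
    by (auto simp: flag_chains_def)
  show "finite (\<Pi>\<^sub>E s\<in>S. {G. G face_of P})"
    by (intro finite_PiE assms finite_polytope_faces)
qed

text \<open>A flag starting with a vertex is the same as that vertex together with a flag of
  positive-dimensional faces that all contain it.\<close>

lemma flag_f_insert_0:
  fixes P :: "'a::euclidean_space set"
  assumes P: "polytope P" and T: "finite T"
  shows "flag_f P (insert 0 (Suc ` T)) =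
    (\<Sum>v\<in>vert P. card {F \<in> flag_chains P (Suc ` T). \<forall>t\<in>T. v \<in> F (Suc t)})"
proof -
  define C where "C v = {F \<in> flag_chains P (Suc ` T). \<forall>t\<in>T. v \<in> F (Suc t)}" for v
  have "bij_betw (\<lambda>(v, F). F(0 := {v})) (Sigma (vert P) C) (flag_chains P (insert 0 (Suc ` T)))"
  proof (rule bij_betw_byWitness[where f' = "\<lambda>K. (the_elem (K 0), restrict K (Suc ` T))"])
    show "\<forall>x\<in>Sigma (vert P) C. (\<lambda>K. (the_elem (K 0), restrict K (Suc ` T))) ((\<lambda>(v, F). F(0 := {v})) x) = x"
    proof
      fix x assume "x \<in> Sigma (vert P) C"
      then obtain v F where x: "x = (v, F)" "F \<in> C v"
        by auto
      then have "F \<in> extensional (Suc ` T)"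
        by (auto simp: C_def flag_chains_def PiE_def)
      then have "restrict (F(0 := {v})) (Suc ` T) = F"
        by (auto simp: fun_eq_iff extensional_def)
      then show "(\<lambda>K. (the_elem (K 0), restrict K (Suc ` T))) ((\<lambda>(v, F). F(0 := {v})) x) = x"
        by (simp add: x)
    qed
    have vertex: "\<exists>v\<in>vert P. K 0 = {v}" if "K \<in> flag_chains P (insert 0 (Suc ` T))" for K
    proof -
      have "K 0 face_of P" "aff_dim (K 0) = 0"
        using that by (auto simp: flag_chains_def PiE_iff)
      then show ?thesis
        using face_of_singleton by (fastforce simp: aff_dim_eq_0 vert_def)
    qed
    show "\<forall>K\<in>flag_chains P (insert 0 (Suc ` T)).
        (\<lambda>(v, F). F(0 := {v})) (the_elem (K 0), restrict K (Suc ` T)) = K"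
    proof
      fix K assume K: "K \<in> flag_chains P (insert 0 (Suc ` T))"
      then have "K \<in> extensional (insert 0 (Suc ` T))"
        by (auto simp: flag_chains_def PiE_def)
      then show "(\<lambda>(v, F). F(0 := {v})) (the_elem (K 0), restrict K (Suc ` T)) = K"
        using vertex[OF K] by (auto simp: fun_eq_iff extensional_def)
    qed
    show "(\<lambda>(v, F). F(0 := {v})) ` Sigma (vert P) C \<subseteq> flag_chains P (insert 0 (Suc ` T))"
    proof clarify
      fix v F assume v: "v \<in> vert P" and F: "F \<in> C v"
      have above: "{v} \<subset> F (Suc t)" if "t \<in> T" for t
      proof -
        have "aff_dim (F (Suc t)) = 1 + int t"
          using F that by (auto simp: C_def flag_chains_def PiE_iff)
        then have "F (Suc t) \<noteq> {v}"
          by auto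
        then show ?thesis
          using F that by (auto simp: C_def)
      qed
      have mono: "strict_mono_on (Suc ` T) F"
        using F by (simp add: C_def flag_chains_def)
      have "strict_mono_on (insert 0 (Suc ` T)) (F(0 := {v}))"
      proof (rule strict_mono_onI)
        fix r s assume rs: "r \<in> insert 0 (Suc ` T)" "s \<in> insert 0 (Suc ` T)" "r < s"
        show "(F(0 := {v})) r < (F(0 := {v})) s"
        proof (cases "r = 0")
          case True
          then show ?thesis
            using rs above by auto
        next
          case False
          then show ?thesis
            using rs strict_mono_onD[OF mono, of r s] by simp
        qed
      qed
      then show "F(0 := {v}) \<in> flag_chains P (insert 0 (Suc ` T))"
        using v F
        by (auto simp: C_def flag_chains_def PiE_iff vert_def face_of_singleton extensional_def)
    qed
    show "(\<lambda>K. (the_elem (K 0), restrict K (Suc ` T))) ` flag_chains P (insert 0 (Suc ` T))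
        \<subseteq> Sigma (vert P) C"
    proof clarify
      fix K assume K: "K \<in> flag_chains P (insert 0 (Suc ` T))"
      obtain v where v: "v \<in> vert P" "K 0 = {v}"
        using vertex[OF K] by blast
      have mono: "strict_mono_on (insert 0 (Suc ` T)) K"
        using K by (simp add: flag_chains_def)
      have "v \<in> K (Suc t)" if "t \<in> T" for t
        using strict_mono_onD[OF mono, of 0 "Suc t"] that v(2) by auto
      moreover have "restrict K (Suc ` T) \<in> flag_chains P (Suc ` T)"
        using K by (auto simp: flag_chains_def PiE_iff strict_mono_on_def)
      ultimately show "the_elem (K 0) \<in> vert P \<and> restrict K (Suc ` T) \<in> C (the_elem (K 0))"
        using v by (simp add: C_def)
    qed
  qed
  moreover have "finite (C v)" for v
    using finite_flag_chains[OF P, of "Suc ` T"] T by (simp add: C_def)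
  ultimately show ?thesis
    using finite_vert[OF P] by (auto simp: flag_f_def C_def dest!: bij_betw_same_card)
qed

text \<open>
  \<open>bottom\<close> is the lowest face of the chain, or \<open>P\<close> for the empty chain: a vertex of
  \<open>bottom\<close> that is not extremal on it is not extremal on any larger face either.
\<close>

lemma flag_f_double_count:
  fixes P :: "'a::euclidean_space set"
  assumes P: "polytope P" "1 \<le> aff_dim P" and T: "finite T"
    and inj: "inj_on (\<lambda>x. p \<bullet> x) (vert P)"
    and fig: "\<forall>v\<in>vert P. is_vertex_figure P v (Q v)"
  shows "(\<Sum>v\<in>vert P. flag_f (Q v) T) =
    2 * flag_f P (Suc ` T) +
    (\<Sum>v\<in>vert P. if Q v \<inter> sweep_hyperplane p v = {} then 0 else level_count (Q v) p v T)"
proof -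
  let ?C = "flag_chains P (Suc ` T)"
  have fin: "finite ?C"
    using finite_flag_chains[OF P(1)] T by simp
  define bottom where "bottom F = (if T = {} then P else F (Suc (Min T)))" for F :: "nat \<Rightarrow> 'a set"
  have faceP: "P face_of P"
    using P(1) face_of_refl polytope_imp_convex by blast
  have bottom: "bottom F face_of P" "1 \<le> aff_dim (bottom F)" if "F \<in> ?C" for F
    using that P(2) faceP Min_in[OF T] by (auto simp: bottom_def flag_chains_def PiE_iff)
  have bottom_subset: "bottom F \<subseteq> F (Suc t)" if "F \<in> ?C" "t \<in> T" for F t
  proof (cases "t = Min T")
    case False
    then have "Min T < t"
      using Min_le[OF T that(2)] by simp
    moreover have "strict_mono_on (Suc ` T) F"
      using that(1) by (simp add: flag_chains_def)
    ultimately have "F (Suc (Min T)) \<subset> F (Suc t)"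
      using that(2) Min_in[OF T] by (auto simp: strict_mono_on_def)
    then show ?thesis
      using that(2) by (auto simp: bottom_def)
  qed (use that in \<open>auto simp: bottom_def\<close>)
  have through: "(\<forall>t\<in>T. v \<in> F (Suc t)) \<longleftrightarrow> v \<in> bottom F" if "F \<in> ?C" "v \<in> vert P" for F v
  proof (cases "T = {}")
    case True
    then show ?thesis
      using that(2) vert_subset by (auto simp: bottom_def)
  next
    case False
    then show ?thesis
      using bottom_subset[OF that(1)] Min_in[OF T False] unfolding bottom_def by auto
  qed
  \<comment> \<open>The conjunct on \<open>P\<close> matters for empty \<open>T\<close>, where the
    lowest face is \<open>P\<close> itself.\<close>
  have nonext: "(\<forall>t\<in>T. \<not> extremal p v (F (Suc t))) \<and> \<not> extremal p v P \<longleftrightarrow> \<not> extremal p v (bottom F)"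
    if "F \<in> ?C" for F v
  proof -
    have "bottom F \<subseteq> P"
      using bottom(1)[OF that] face_of_imp_subset by blast
    then have "extremal p v P \<Longrightarrow> extremal p v (bottom F)"
      "\<And>t. t \<in> T \<Longrightarrow> extremal p v (F (Suc t)) \<Longrightarrow> extremal p v (bottom F)"
      using bottom_subset[OF that] by (auto intro: extremal_subset)
    moreover have "bottom F = P \<or> (\<exists>t\<in>T. bottom F = F (Suc t))"
      using Min_in[OF T] by (auto simp: bottom_def)
    ultimately show ?thesis
      by auto
  qed
  \<comment> \<open>Flags through v are split by whether v is extremal on the lowest face. The
    non-extremal ones are counted by \<open>level_count\<close>, and there are none if v is extremal
    on \<open>P\<close>.\<close>
  let ?A = "\<lambda>v. {F \<in> ?C. v \<in> bottom F \<and> extremal p v (bottom F)}"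
  have split: "flag_f (Q v) T =
      card (?A v) + (if Q v \<inter> sweep_hyperplane p v = {} then 0 else level_count (Q v) p v T)"
    if v: "v \<in> vert P" for v
  proof -
    obtain a \<beta> where "swept_vertex P p v a \<beta> (Q v) {x. a \<bullet> x = \<beta>}"
      using swept_vertexE[OF P inj v bspec[OF fig v]] by blast
    then interpret swept_vertex P p v a \<beta> "Q v" "{x. a \<bullet> x = \<beta>}" .
    let ?B = "{F \<in> ?C. v \<in> bottom F \<and> \<not> extremal p v (bottom F)}"
    have "{F \<in> ?C. \<forall>t\<in>T. v \<in> F (Suc t)} = ?A v \<union> ?B"
      using through v by blast
    then have "flag_f (Q v) T = card (?A v \<union> ?B)"
      by (simp only: flag_f_Q)
    also have "\<dots> = card (?A v) + card ?B"
      by (rule card_Un_disjoint) (use fin in auto)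
    also have "card ?B = (if extremal p v P then 0 else level_count (Q v) p v T)"
    proof (cases "extremal p v P")
      case True
      then have "?B = {}"
        using nonext by blast
      then show ?thesis
        using True by (simp only: card.empty if_True)
    next
      case False
      then have "?B = {F \<in> ?C. \<forall>t\<in>T. v \<in> F (Suc t) \<and> \<not> extremal p v (F (Suc t))}"
        using through[OF _ v] nonext by blast
      then show ?thesis
        using False by (simp add: level_count_eq)
    qed
    finally show ?thesis
      by (simp add: section_empty_iff)
  qed
  \<comment> \<open>Summing over flags first, each contributes the two extremal vertices of its
    lowest face.\<close>
  have "(\<Sum>v\<in>vert P. card (?A v)) = (\<Sum>F\<in>?C. card {v \<in> vert P. v \<in> bottom F \<and> extremal p v (bottom F)})"
    by (rule sum_multicount_gen) (use finite_vert[OF P(1)] fin in auto)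
  also have "\<dots> = (\<Sum>F\<in>?C. 2)"
  proof (rule sum.cong[OF refl])
    fix F assume F: "F \<in> ?C"
    note face = bottom(1)[OF F]
    have "{v \<in> vert P. v \<in> bottom F \<and> extremal p v (bottom F)} =
        {v \<in> vert (bottom F). extremal p v (bottom F)}"
      using mem_vert_face[OF face] by blast
    also have "card \<dots> = 2"
    proof (rule card_extremal_vert)
      show "polytope (bottom F)"
        using face P(1) face_of_polytope_polytope by blast
      show "inj_on (\<lambda>x. p \<bullet> x) (vert (bottom F))"
        by (rule inj_on_subset[OF inj]) (use mem_vert_face[OF face] in blast)
    qed (rule bottom(2)[OF F])
    finally show "card {v \<in> vert P. v \<in> bottom F \<and> extremal p v (bottom F)} = 2" .
  qed
  also have "\<dots> = 2 * flag_f P (Suc ` T)"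
    by (simp add: flag_f_def)
  finally show ?thesis
    by (simp add: split sum.distrib)
qed

subsection \<open>The sweep recursion\<close>

text \<open>Splitting off the first factor gives \<Psi>(P) = (a - b)X + b Y, where Y comes from
  flags with a vertex and X from those without. Here Y is the sum of \<Psi>(\<open>Q_v\<close>), and
  the double count gives X as half the sum of \<Psi>(\<open>Q_v\<close>) - (a -
  b)\<Psi>(\<open>R_v\<close>). Finally (a - b) + 2b = a + b.\<close>

lemma ab_index_sweep:
  fixes P :: "'a::euclidean_space set"
  assumes P: "polytope P" "1 \<le> aff_dim P"
    and inj: "inj_on (\<lambda>x. p \<bullet> x) (vert P)"
    and fig: "\<forall>v\<in>vert P. is_vertex_figure P v (Q v)"
  shows "ab_index P = (\<Sum>v\<in>vert P. nc_scalar (1 / 2) *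
     ((nc_word [LA] + nc_word [LB]) * ab_index (Q v) -
      (nc_word [LA] - nc_word [LB]) ^ 2 *
        (if Q v \<inter> sweep_hyperplane p v = {} then 0 else ab_index (Q v \<inter> sweep_hyperplane p v))))"
proof -
  obtain d where d: "aff_dim P = 1 + int d"
    using P(2) by (metis zle_iff_zadd)
  let ?a = "nc_word [LA]" and ?b = "nc_word [LB]"
  let ?R = "\<lambda>v. Q v \<inter> sweep_hyperplane p v"
  let ?r = "\<lambda>v T. if ?R v = {} then 0 else level_count (Q v) p v T"
  let ?\<Psi>R = "\<lambda>v. if ?R v = {} then 0 else ab_index (?R v)"
  have Q: "ab_index (Q v) = flag_gen d (\<lambda>T. of_nat (flag_f (Q v) T))"
    and R: "flag_gen d (\<lambda>T. of_nat (?r v T)) = (?a - ?b) * ?\<Psi>R v" if v: "v \<in> vert P" for v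
  proof -
    obtain a \<beta> where "swept_vertex P p v a \<beta> (Q v) {x. a \<bullet> x = \<beta>}"
      using swept_vertexE[OF P inj v bspec[OF fig v]] by blast
    then interpret swept_vertex P p v a \<beta> "Q v" "{x. a \<bullet> x = \<beta>}" .
    show "ab_index (Q v) = flag_gen d (\<lambda>T. of_nat (flag_f (Q v) T))"
      by (simp add: ab_index_eq_flag_gen aff_dim_Q d)
    show "flag_gen d (\<lambda>T. of_nat (?r v T)) = (?a - ?b) * ?\<Psi>R v"
    proof (cases "?R v = {}")
      case False
      then have dim: "aff_dim (?R v) = int d - 1"
        using aff_dim_R d by simp
      moreover have "0 \<le> aff_dim (?R v)"
        using False aff_dim_negative_iff by (metis not_le)
      ultimately obtain e where e: "d = Suc e"
        by (cases d) auto
      then have "ab_index (?R v) = flag_gen e (\<lambda>T. of_nat (flag_f (?R v) T))"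
        by (simp add: ab_index_eq_flag_gen dim)
      then show ?thesis
        \<comment> \<open>Sets containing 0 contribute nothing, so only the summand with first
          factor a - b survives.\<close>
        using False by (simp add: e flag_gen_Suc level_count_Suc level_count_zero)
    qed simp
  qed
  let ?g = "\<lambda>T. of_nat (flag_f P (Suc ` T)) :: rat"
  have low: "flag_gen d (\<lambda>T. of_nat (flag_f P (insert 0 (Suc ` T)))) = (\<Sum>v\<in>vert P. ab_index (Q v))"
  proof -
    have "of_nat (flag_f P (insert 0 (Suc ` T))) = (\<Sum>v\<in>vert P. of_nat (flag_f (Q v) T) :: rat)"
      if "T \<subseteq> {..<d}" for T
    proof -
      have "finite T"
        using that finite_subset by blast
      moreover have "flag_f (Q v) T = card {F \<in> flag_chains P (Suc ` T). \<forall>t\<in>T. v \<in> F (Suc t)}"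
        if v: "v \<in> vert P" for v
      proof -
        obtain a \<beta> where "swept_vertex P p v a \<beta> (Q v) {x. a \<bullet> x = \<beta>}"
          using swept_vertexE[OF P inj v bspec[OF fig v]] by blast
        then show ?thesis
          by (rule swept_vertex.flag_f_Q)
      qed
      ultimately show ?thesis
        using flag_f_insert_0[OF P(1)] by simp
    qed
    then show ?thesis
      by (simp add: Q flag_gen_sum cong: flag_gen_cong)
  qed
  have half: "flag_gen d ?g =
      (\<Sum>v\<in>vert P. nc_scalar (1 / 2) * (ab_index (Q v) - (?a - ?b) * ?\<Psi>R v))"
  proof -
    have "?g T = (\<Sum>v\<in>vert P. 1 / 2 * (of_nat (flag_f (Q v) T) - of_nat (?r v T)))"
      if "T \<subseteq> {..<d}" for T
    proof -
      have T: "finite T"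
        using that finite_subset by blast
      have solve: "x = 2 * y + z \<Longrightarrow> y = 1 / 2 * (x - z)" for x y z :: rat
        by simp
      from arg_cong[where f = "of_nat :: nat \<Rightarrow> rat", OF flag_f_double_count[OF P T inj fig]]
      have "(\<Sum>v\<in>vert P. of_nat (flag_f (Q v) T) :: rat) = 2 * ?g T + (\<Sum>v\<in>vert P. of_nat (?r v T))"
        by (simp only: of_nat_sum of_nat_add of_nat_mult of_nat_numeral)
      then have "?g T = 1 / 2 * ((\<Sum>v\<in>vert P. of_nat (flag_f (Q v) T)) - (\<Sum>v\<in>vert P. of_nat (?r v T)))"
        by (rule solve)
      then show ?thesis
        by (simp only: sum_distrib_left[symmetric] sum_subtractf)
    qed
    then have "flag_gen d ?g =
        flag_gen d (\<lambda>T. \<Sum>v\<in>vert P. 1 / 2 * (of_nat (flag_f (Q v) T) - of_nat (?r v T)))"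
      by (rule flag_gen_cong)
    also have "\<dots> = (\<Sum>v\<in>vert P. nc_scalar (1 / 2) * (ab_index (Q v) - (?a - ?b) * ?\<Psi>R v))"
      by (simp only: flag_gen_sum flag_gen_cmult flag_gen_diff) (intro sum.cong refl, simp only: Q R)
    finally show ?thesis .
  qed
  \<comment> \<open>Brings the second summand under the common factor 1/2.\<close>
  have b: "?b * x = nc_scalar (1 / 2) * (2 * (?b * x))" for x
  proof -
    have "nc_scalar (1 / 2) * (2 * y) = y" for y :: "ab_letter ncpoly"
    proof -
      have "nc_scalar (1 / 2) * (2 * y) = (nc_scalar (1 / 2) + nc_scalar (1 / 2)) * y"
        by (simp add: mult_2 distrib_left distrib_right)
      then show ?thesis
        by (simp flip: nc_scalar_add)
    qed
    then show ?thesis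
      by simp
  qed
  have "ab_index P = (?a - ?b) * flag_gen d ?g + ?b * (\<Sum>v\<in>vert P. ab_index (Q v))"
    using flag_gen_Suc[of d "\<lambda>T. of_nat (flag_f P T)"] low
    by (simp add: ab_index_eq_flag_gen d nat_add_distrib)
  also have "\<dots> = (\<Sum>v\<in>vert P. nc_scalar (1 / 2) *
      ((?a - ?b) * (ab_index (Q v) - (?a - ?b) * ?\<Psi>R v) + 2 * (?b * ab_index (Q v))))"
    unfolding half sum_distrib_left nc_scalar_left_commute[of "?a - ?b"]
    by (subst b) (simp only: sum.distrib distrib_left)
  also have "\<dots> = (\<Sum>v\<in>vert P. nc_scalar (1 / 2) *
      ((?a + ?b) * ab_index (Q v) - (?a - ?b) ^ 2 * ?\<Psi>R v))"
    by (intro sum.cong refl arg_cong2[where f = "(*)"])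
      (simp only: power2_eq_square mult_2 distrib_left distrib_right left_diff_distrib
        right_diff_distrib mult.assoc algebra_simps)
  finally show ?thesis .
qed

section \<open>Generic directions and existence of the cd-index\<close>

lemma exists_nonorthogonal:
  fixes D :: "'a::euclidean_space set"
  assumes "finite D" "0 \<notin> D"
  obtains p where "\<And>x. x \<in> D \<Longrightarrow> p \<bullet> x \<noteq> 0"
proof -
  have "\<exists>p. \<forall>x\<in>D. p \<bullet> x \<noteq> 0"
    using assms
  proof induction
    case (insert y D)
    then obtain p where p: "\<forall>x\<in>D. p \<bullet> x \<noteq> 0"
      by auto
    \<comment> \<open>If \<open>y \<bullet> x \<noteq> 0\<close>, exactly one t makes
      \<open>p + t *\<^sub>R y\<close> orthogonal to x, and it is listed here. If
      \<open>y \<bullet> x = 0\<close>, then x differs from y and the old p already works for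
      x.\<close>
    define bad where "bad = (\<lambda>x. - (p \<bullet> x) / (y \<bullet> x)) ` insert y D"
    obtain t where t: "t \<notin> insert 0 bad"
      using ex_new_if_finite[of "insert 0 bad"] insert.hyps(1) infinite_UNIV_char_0 by (auto simp: bad_def)
    have "(p + t *\<^sub>R y) \<bullet> x \<noteq> 0" if x: "x \<in> insert y D" for x
    proof (cases "y \<bullet> x = 0")
      case True
      then have "x \<in> D"
        using x insert.prems by auto
      then show ?thesis
        using p True by (simp add: inner_simps)
    next
      case False
      have "t \<noteq> - (p \<bullet> x) / (y \<bullet> x)"
        using t x by (auto simp: bad_def)
      then show ?thesis
        using False by (simp add: inner_simps field_simps)
    qed
    then show ?case
      by blast
  qed simp
  then show ?thesis
    using that by blast
qed

lemma exists_generic_direction: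
  fixes V :: "'a::euclidean_space set"
  assumes "finite V"
  obtains p where "inj_on (\<lambda>x. p \<bullet> x) V"
proof -
  let ?D = "(\<lambda>(x, y). x - y) ` (V \<times> V) - {0}"
  obtain p where p: "\<And>x. x \<in> ?D \<Longrightarrow> p \<bullet> x \<noteq> 0"
    using exists_nonorthogonal[of ?D] assms by auto
  have "inj_on (\<lambda>x. p \<bullet> x) V"
  proof (rule inj_onI, rule ccontr)
    fix x y assume "x \<in> V" "y \<in> V" "p \<bullet> x = p \<bullet> y" "x \<noteq> y"
    then show False
      using p[of "x - y"] by (force simp: inner_diff_right)
  qed
  then show ?thesis
    using that by blast
qed

text \<open>The point is that 2d - c^2 is sent to -(a - b)^2.\<close>

lemma cd_to_ab_sweep_term:
  "cd_to_ab (nc_scalar q * (c_poly * x + (2 * d_poly - c_poly ^ 2) * y)) =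
   nc_scalar q * ((nc_word [LA] + nc_word [LB]) * cd_to_ab x -
     (nc_word [LA] - nc_word [LB]) ^ 2 * cd_to_ab y)"
proof -
  have "cd_to_ab (2 * d_poly - c_poly ^ 2) = - ((nc_word [LA] - nc_word [LB]) ^ 2)"
    by (simp add: cd_to_ab_mult cd_to_ab_add cd_to_ab_diff cd_to_ab_c cd_to_ab_d
        power2_eq_square mult_2 algebra_simps)
  then show ?thesis
    by (simp add: cd_to_ab_mult cd_to_ab_add cd_to_ab_c)
qed

lemma ab_index_point:
  assumes "aff_dim X = 0"
  shows "ab_index X = 1"
proof -
  have "flag_chains X {} = {\<lambda>x. undefined}"
    by (auto simp: flag_chains_def)
  then show ?thesis
    using assms by (simp add: ab_index_eq_flag_gen flag_gen_def flag_f_def flag_word_def)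
qed

text \<open>Strong induction on the dimension: with any generic direction and any choice of vertex
  figures, the recursion writes \<Psi>(P) through indices of lower dimension, with coefficients in
  the image of the substitution.\<close>

lemma ab_index_in_range:
  fixes P :: "'a::euclidean_space set"
  assumes "polytope P" "P \<noteq> {}"
  shows "ab_index P \<in> range cd_to_ab"
  using assms
proof (induction "nat (aff_dim P)" arbitrary: P rule: less_induct)
  case less
  have nonneg: "0 \<le> aff_dim P"
    using less.prems aff_dim_negative_iff by (metis not_le)
  show ?case
  proof (cases "aff_dim P = 0")
    case True
    then show ?thesis
      using ab_index_point cd_to_ab_1 by (metis rangeI)
  next
    case False
    then have dim: "1 \<le> aff_dim P"
      using nonneg by simp
    obtain p where inj: "inj_on (\<lambda>x. p \<bullet> x) (vert P)"
      using exists_generic_direction finite_vert less.prems(1) by blast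
    have "\<forall>v\<in>vert P. \<exists>Q. is_vertex_figure P v Q"
      using vertex_figure_exists[OF less.prems(1) dim] by metis
    then obtain Q where Q: "\<forall>v\<in>vert P. is_vertex_figure P v (Q v)"
      by metis
    let ?R = "\<lambda>v. Q v \<inter> sweep_hyperplane p v"
    have "\<exists>x y. ab_index (Q v) = cd_to_ab x \<and> (if ?R v = {} then 0 else ab_index (?R v)) = cd_to_ab y"
      if v: "v \<in> vert P" for v
    proof -
      obtain a \<beta> where "swept_vertex P p v a \<beta> (Q v) {x. a \<bullet> x = \<beta>}"
        using swept_vertexE[OF less.prems(1) dim inj v bspec[OF Q v]] by blast
      then interpret swept_vertex P p v a \<beta> "Q v" "{x. a \<bullet> x = \<beta>}" .
      have "Q v \<noteq> {}"
        using aff_dim_Q dim by force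
      then have "ab_index (Q v) \<in> range cd_to_ab"
        using aff_dim_Q dim by (intro less.hyps polytope_Q) auto
      moreover have "ab_index (?R v) \<in> range cd_to_ab" if "?R v \<noteq> {}"
        using aff_dim_R[OF that] dim that by (intro less.hyps polytope_R) auto
      ultimately show ?thesis
        using cd_to_ab_0 by (metis imageE)
    qed
    then obtain x y where xy: "\<And>v. v \<in> vert P \<Longrightarrow> ab_index (Q v) = cd_to_ab (x v)"
      "\<And>v. v \<in> vert P \<Longrightarrow> (if ?R v = {} then 0 else ab_index (?R v)) = cd_to_ab (y v)"
      by metis
    have "ab_index P = (\<Sum>v\<in>vert P. cd_to_ab (nc_scalar (1 / 2) *
        (c_poly * x v + (2 * d_poly - c_poly ^ 2) * y v)))"
      unfolding ab_index_sweep[OF less.prems(1) dim inj Q] cd_to_ab_sweep_term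
      by (intro sum.cong refl) (simp only: xy)
    then show ?thesis
      by (simp flip: cd_to_ab_sum)
  qed
qed

section \<open>The recursion for the cd-index\<close>

lemma cd_index_eqI: "X \<noteq> {} \<Longrightarrow> cd_to_ab \<phi> = ab_index X \<Longrightarrow> cd_index X = \<phi>"
  unfolding cd_index_def using inj_cd_to_ab by (auto simp: inj_def intro!: the_equality)

lemma cd_to_ab_cd_index:
  fixes P :: "'a::euclidean_space set"
  assumes "polytope P"
  shows "cd_to_ab (cd_index P) = (if P = {} then 0 else ab_index P)"
proof (cases "P = {}")
  case False
  then obtain \<phi> where "cd_to_ab \<phi> = ab_index P"
    using ab_index_in_range[OF assms] by (metis imageE)
  then show ?thesis
    using False cd_index_eqI by metis
qed (simp add: cd_index_def)

text \<open>The substitution is injective, so comparing images suffices, and there the identity is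
  the recursion for \<Psi>.\<close>

lemma cd_index_sweep:
  fixes P :: "'a::euclidean_space set"
  assumes P: "polytope P" "1 \<le> aff_dim P"
    and inj: "inj_on (\<lambda>x. p \<bullet> x) (vert P)"
    and fig: "\<forall>v\<in>vert P. is_vertex_figure P v (Q v)"
  shows "cd_index P = (\<Sum>v\<in>vert P. nc_scalar (1 / 2) *
     (c_poly * cd_index (Q v) +
      (2 * d_poly - c_poly ^ 2) * cd_index (Q v \<inter> sweep_hyperplane p v)))"
proof (rule cd_index_eqI)
  show "P \<noteq> {}"
    using P(2) by auto
  have "cd_to_ab (cd_index (Q v)) = ab_index (Q v)"
    "cd_to_ab (cd_index (Q v \<inter> sweep_hyperplane p v)) =
      (if Q v \<inter> sweep_hyperplane p v = {} then 0 else ab_index (Q v \<inter> sweep_hyperplane p v))"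
    if v: "v \<in> vert P" for v
  proof -
    obtain a \<beta> where "swept_vertex P p v a \<beta> (Q v) {x. a \<bullet> x = \<beta>}"
      using swept_vertexE[OF P inj v bspec[OF fig v]] by blast
    then interpret swept_vertex P p v a \<beta> "Q v" "{x. a \<bullet> x = \<beta>}" .
    have "Q v \<noteq> {}"
      using aff_dim_Q P(2) by force
    then show "cd_to_ab (cd_index (Q v)) = ab_index (Q v)"
      by (simp add: cd_to_ab_cd_index polytope_Q)
    show "cd_to_ab (cd_index (Q v \<inter> sweep_hyperplane p v)) =
      (if Q v \<inter> sweep_hyperplane p v = {} then 0 else ab_index (Q v \<inter> sweep_hyperplane p v))"
      by (rule cd_to_ab_cd_index[OF polytope_R])
  qed
  then show "cd_to_ab (\<Sum>v\<in>vert P. nc_scalar (1 / 2) * (c_poly * cd_index (Q v) +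
      (2 * d_poly - c_poly ^ 2) * cd_index (Q v \<inter> sweep_hyperplane p v))) = ab_index P"
    unfolding ab_index_sweep[OF P inj fig] cd_to_ab_sum cd_to_ab_sweep_term
    by (intro sum.cong refl) (simp only:)
qed

text \<open>The dimension of P is the number of coordinates. It is at least 1 for every finite index
  type, so the case d = 0 is a separate conjunct about points.\<close>

theorem theorem3:
  fixes P :: "(real ^ 'n) set" and p :: "real ^ 'n"
    and Q R :: "real ^ 'n \<Rightarrow> (real ^ 'n) set"
  assumes "polytope P" and "aff_dim P = int CARD('n)"
    and "inj_on (\<lambda>x. p \<bullet> x) (vert P)"
    and "\<And>v. v \<in> vert P \<Longrightarrow> is_vertex_figure P v (Q v)"
    and "\<And>v. v \<in> vert P \<Longrightarrow> inj_on (\<lambda>x. p \<bullet> x) (vert (Q v))"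
    and "\<And>v. v \<in> vert P \<Longrightarrow> R v = Q v \<inter> sweep_hyperplane p v"
  shows "cd_index P =
      (\<Sum>v\<in>vert P. nc_scalar (1 / 2) *
         (c_poly * cd_index (Q v) + (2 * d_poly - c_poly ^ 2) * cd_index (R v))) \<and>
    (\<forall>X::(real ^ 'n) set. polytope X \<and> aff_dim X = 0 \<longrightarrow> cd_index X = 1)"
proof (intro conjI allI impI)
  \<comment> \<open>This is d > 0: types are nonempty, so \<open>CARD('n)\<close> is
    positive.\<close>
  have "1 \<le> aff_dim P"
    using assms(2) zero_less_card_finite[where 'a = 'n] by linarith
  moreover have "\<forall>v\<in>vert P. is_vertex_figure P v (Q v)"
    using assms(4) by blast
  ultimately show "cd_index P = (\<Sum>v\<in>vert P. nc_scalar (1 / 2) *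
      (c_poly * cd_index (Q v) + (2 * d_poly - c_poly ^ 2) * cd_index (R v)))"
    using cd_index_sweep[OF assms(1) _ assms(3)] assms(6) by simp
  show "cd_index X = 1" if "polytope X \<and> aff_dim X = 0" for X :: "(real ^ 'n) set"
    using that by (intro cd_index_eqI) (auto simp: ab_index_point)
qed

end
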